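(* Let $q$ be an odd prime power. Let $n\geq 1$ and let $\beta$ be an even integer with $\beta\neq 0$ and $\beta<n$. Then \[ S(\beta;n)=\pi_q(n)\bigl(q^{\frac{\beta}{2}}-\eta_n\, q^{\beta-\frac{n}{2}}\bigr)+O(q^n), \] where $\eta_n=1$ if $n$ is even and $\eta_n=0$ if $n$ is odd.
   Context: $\mathbb{F}_q$ is a finite field with $q$ odd. For monic irreducible $P\in\mathbb{F}_q[x]$ and $B\in\mathbb{F}_q[x]$, $\left(\frac{B}{P}\right)$ denotes the quadratic residue symbol in $\mathbb{F}_q[x]$ (equal to $0$ if $P\mid B$, $1$ if $B$ is a nonzero square mod $P$, $-1$ otherwise). Define \[ S(\beta;n):=\sum_{\deg(P)=n}\ \sum_{\deg(B)=\beta}\left(\frac{B}{P}\right), \] where $P$ runs over monic irreducible polynomials of degree $n$ and $B$ over monic polynomials of degree $\beta$. $\pi_q(n)$ denotes the number of monic irreducible polynomials of degree $n$ in $\mathbb{F}_q[x]$. *)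

theory Defs
  imports
    Complex_Main
    "HOL-Library.Cardinality"
    "HOL-Computational_Algebra.Polynomial"
    "HOL-Number_Theory.Cong"
begin

text \<open>
  The field with \<open>q\<close> elements is a type \<open>'a\<close> of classes \<open>field\<close> and \<open>finite\<close>, with
  \<open>q = CARD('a)\<close>. Constants whose arguments and value do not mention \<open>'a\<close> take it as an
  argument \<open>TYPE('a)\<close>.
\<close>

definition monic_polys :: "nat \<Rightarrow> 'a::{field,finite} poly set" where
  "monic_polys n = {B. lead_coeff B = 1 \<and> degree B = n}"

definition monic_irreducibles :: "nat \<Rightarrow> 'a::{field,finite} poly set" where
  "monic_irreducibles n = {P \<in> monic_polys n. irreducible P}"

text \<open>Sums over these sets, and their cardinalities, are not junk values:\<close>

lemma finite_monic_polys: "finite (monic_polys n :: 'a::{field,finite} poly set)"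
proof (rule finite_subset)
  show "(monic_polys n :: 'a poly set) \<subseteq> Poly ` {xs. set xs \<subseteq> UNIV \<and> length xs \<le> Suc n}"
  proof
    fix B :: "'a poly" assume "B \<in> monic_polys n"
    then have "length (coeffs B) \<le> Suc n"
      by (cases "B = 0") (auto simp: monic_polys_def length_coeffs_degree)
    then show "B \<in> Poly ` {xs. set xs \<subseteq> UNIV \<and> length xs \<le> Suc n}"
      by (auto intro!: image_eqI[of _ _ "coeffs B"])
  qed
  show "finite (Poly ` {xs :: 'a list. set xs \<subseteq> UNIV \<and> length xs \<le> Suc n})"
    by (intro finite_imageI finite_lists_length_le) simp
qed

lemma finite_monic_irreducibles:
  "finite (monic_irreducibles n :: 'a::{field,finite} poly set)"
  by (rule finite_subset[OF _ finite_monic_polys[of n]]) (auto simp: monic_irreducibles_def)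

definition prime_count :: "'a::{field,finite} itself \<Rightarrow> nat \<Rightarrow> nat" where
  "prime_count _ n = card (monic_irreducibles n :: 'a poly set)"

definition quad_symbol :: "'a::{field,finite} poly \<Rightarrow> 'a poly \<Rightarrow> int" where
  "quad_symbol B P =
     (if P dvd B then 0 else if \<exists>A. [A\<^sup>2 = B] (mod P) then 1 else - 1)"

definition S :: "'a::{field,finite} itself \<Rightarrow> nat \<Rightarrow> nat \<Rightarrow> int" where
  "S _ \<beta> n = (\<Sum>P\<in>monic_irreducibles n. \<Sum>B\<in>monic_polys \<beta>. quad_symbol B (P :: 'a poly))"

definition eta :: "nat \<Rightarrow> real" where
  "eta n = (if even n then 1 else 0)"

end

theory Submission
  imports Defs "HOL-Computational_Algebra.Polynomial_Factorial"
begin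

text \<open>
  For \<open>m + k = n - 1\<close> the functional equation of the \<open>L\<close>-function of the character modulo \<open>P\<close>
  expresses the sum over \<open>B\<close> of degree \<open>m\<close> through those of degree at most \<open>k\<close>. On the dual
  side the \<open>q ^ (j / 2)\<close> squares of even degree \<open>j\<close> produce the main term, and all other \<open>B\<close> are
  estimated individually by the Riemann hypothesis for the curve \<open>y\<^sup>2 = B(x)\<close>, so that the total
  error is \<open>O(q ^ n)\<close>.

  The functional equation is Poisson summation on the residue ring modulo \<open>P\<close>. Additive
  characters are avoided by integer valued kernels \<open>h\<close> on the field of constants with sum zero,
  evaluated at the linear functional \<open>lam\<close> taking the coefficient of \<open>x ^ (n - 1)\<close>; for \<open>n\<close> odd
  \<open>h\<close> is the quadratic character of the constants, for \<open>n\<close> even it is \<open>q - 1\<close> at \<open>0\<close> and \<open>-1\<close>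
  elsewhere.

  The Riemann hypothesis is obtained by Stepanov's method in Bombieri's form: a polynomial
  \<open>R\<close> of degree \<open>q ^ n / 2 + O(n q ^ (n / 2))\<close> is divisible by every \<open>P\<close> of degree \<open>n\<close> at which
  \<open>B\<close> has a prescribed symbol \<open>1\<close> or \<open>-1\<close>. Both counts are therefore at most about half of the
  total, and since they add up to the number of all \<open>P\<close>, they are nearly equal.
\<close>

section \<open>Polynomials over a finite field\<close>

lemma power_card_eq_self: "c ^ CARD('a) = (c :: 'a::{field,finite})"
proof (cases "c = 0")
  case True
  then show ?thesis by (simp add: power_0_left)
next
  case False
  have "(\<Prod>x\<in>UNIV-{0}. c * x) = (\<Prod>x\<in>UNIV-{0::'a}. x)"
    by (rule prod.reindex_bij_witness[of _ "\<lambda>x. x / c" "\<lambda>x. c * x"]) (use False in auto)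
  then have "c ^ (CARD('a) - 1) * (\<Prod>x\<in>UNIV-{0::'a}. x) = 1 * (\<Prod>x\<in>UNIV-{0::'a}. x)"
    by (simp add: prod.distrib card_Diff_singleton)
  moreover have "(\<Prod>x\<in>UNIV-{0::'a}. x) \<noteq> 0"
    by (simp add: prod_zero_iff)
  ultimately have "c ^ (CARD('a) - 1) = 1"
    by simp
  then show ?thesis
    by (metis One_nat_def Suc_pred mult.right_neutral power_Suc zero_less_card_finite)
qed

lemma card_field_ge_2: "CARD('a::{field,finite}) \<ge> 2"
proof -
  have "card {0, 1 :: 'a} \<le> CARD('a)"
    by (rule card_mono) auto
  then show ?thesis by simp
qed

text \<open>As a polynomial in c, (c + 1) ^ q - c ^ q - 1 has degree below q but vanishes at all q
  elements of the field, so each of its coefficients is 0.\<close>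

lemma of_nat_card_choose:
  assumes "0 < i" "i < CARD('a::{field,finite})"
  shows "of_nat (CARD('a) choose i) = (0 :: 'a)"
proof -
  let ?q = "CARD('a)"
  define p :: "'a poly" where "p = (\<Sum>j\<in>{1..<?q}. monom (of_nat (?q choose j)) j)"
  have coeff: "coeff p j = (if j \<in> {1..<?q} then of_nat (?q choose j) else 0)" for j
    by (simp add: p_def coeff_sum sum.delta)
  have "poly p c = 0" for c
  proof -
    have "(c + 1) ^ ?q = (\<Sum>j\<le>?q. of_nat (?q choose j) * c ^ j)"
      by (simp add: binomial_ring)
    also have "{..?q} = insert 0 (insert ?q {1..<?q})"
      by auto
    also have "(\<Sum>j\<in>\<dots>. of_nat (?q choose j) * c ^ j) = 1 + (c ^ ?q + poly p c)"
      by (subst sum.insert, simp, simp, subst sum.insert, simp, simp)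
         (simp add: p_def poly_sum poly_monom)
    finally show ?thesis
      by (simp add: power_card_eq_self)
  qed
  moreover have "degree p < ?q"
    by (rule le_less_trans[of _ "?q - 1"], rule degree_le) (auto simp: coeff)
  ultimately have "p = 0"
    using card_poly_roots_bound[of p] by (cases "p = 0") auto
  then show ?thesis
    using coeff[of i] assms by simp
qed

lemma frobenius_add:
  fixes A B :: "'a::{field,finite} poly"
  shows "(A + B) ^ CARD('a) = A ^ CARD('a) + B ^ CARD('a)"
proof -
  let ?q = "CARD('a)"
  have "(A + B) ^ ?q = (\<Sum>j\<le>?q. of_nat (?q choose j) * A ^ j * B ^ (?q - j))"
    by (rule binomial_ring)
  also have "\<dots> = (\<Sum>j\<in>{0, ?q}. of_nat (?q choose j) * A ^ j * B ^ (?q - j))"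
    by (rule sum.mono_neutral_right) (auto simp: of_nat_poly of_nat_card_choose)
  finally show ?thesis by simp
qed

lemma frobenius_power_add:
  fixes A B :: "'a::{field,finite} poly"
  shows "(A + B) ^ (CARD('a) ^ k) = A ^ (CARD('a) ^ k) + B ^ (CARD('a) ^ k)"
proof (induction k)
  case (Suc k)
  have "(A + B) ^ (CARD('a) ^ Suc k) = ((A + B) ^ (CARD('a) ^ k)) ^ CARD('a)"
    by (metis power_Suc2 power_mult)
  also have "\<dots> = A ^ (CARD('a) ^ Suc k) + B ^ (CARD('a) ^ Suc k)"
    unfolding Suc frobenius_add by (metis power_Suc2 power_mult)
  finally show ?case .
qed simp

lemma frobenius_power_diff:
  fixes A B :: "'a::{field,finite} poly"
  shows "(A - B) ^ (CARD('a) ^ k) = A ^ (CARD('a) ^ k) - B ^ (CARD('a) ^ k)"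
  using frobenius_power_add[of "A - B" B k] by (simp add: algebra_simps)

lemma frobenius_power_sum:
  fixes f :: "'b \<Rightarrow> 'a::{field,finite} poly"
  shows "(\<Sum>x\<in>X. f x) ^ (CARD('a) ^ k) = (\<Sum>x\<in>X. f x ^ (CARD('a) ^ k))"
  by (induction X rule: infinite_finite_induct) (auto simp: frobenius_power_add power_0_left)

lemma power_card_power_eq_self: "c ^ (CARD('a) ^ k) = (c :: 'a::{field,finite})"
  by (induction k) (auto simp: power_mult power_card_eq_self)

text \<open>Frobenius is additive and fixes the constants. Such powers thus become substitutions,
  and a congruence for x alone carries over to all polynomials.\<close>

lemma frobenius_eq_pcompose:
  fixes A :: "'a::{field,finite} poly"
  shows "A ^ (CARD('a) ^ k) = pcompose A (monom 1 (CARD('a) ^ k))"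
proof (induction A)
  case 0
  then show ?case by (simp add: power_0_left)
next
  case (pCons a A)
  have "pCons a A = [:a:] + monom 1 1 * A"
    by (simp add: monom_Suc)
  then have "pCons a A ^ (CARD('a) ^ k) = [:a:] ^ (CARD('a) ^ k) + (monom 1 1 * A) ^ (CARD('a) ^ k)"
    by (simp only: frobenius_power_add)
  also have "\<dots> = [:a:] + monom 1 (CARD('a) ^ k) * pcompose A (monom 1 (CARD('a) ^ k))"
    by (simp add: power_mult_distrib pCons monom_power poly_const_pow power_card_power_eq_self)
  finally show ?case
    by (simp add: pcompose_pCons)
qed

lemma of_nat_card_field: "of_nat CARD('a) = (0 :: 'a::{field,finite})"
proof -
  have "(\<Sum>x\<in>UNIV. x + 1) = (\<Sum>x\<in>UNIV. x :: 'a)"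
    by (rule sum.reindex_bij_witness[of _ "\<lambda>x. x - 1" "\<lambda>x. x + 1"]) auto
  then show ?thesis
    by (simp add: sum.distrib)
qed

lemma two_neq_zero:
  assumes "odd CARD('a::{field,finite})"
  shows "(2 :: 'a) \<noteq> 0"
proof
  assume *: "(2 :: 'a) = 0"
  obtain k where "CARD('a) = 2 * k + 1"
    using assms oddE by blast
  then have "of_nat CARD('a) = (2 :: 'a) * of_nat k + 1"
    by simp
  then show False
    by (simp add: * of_nat_card_field)
qed

text \<open>A condition on coefficients rather than on \<open>degree\<close>: it admits the zero
  polynomial also for k = 0 and visibly describes a space of dimension k over the field of
  constants.\<close>

definition polys_below :: "nat \<Rightarrow> 'a::zero poly set" where
  "polys_below k = {A. \<forall>i\<ge>k. coeff A i = 0}"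

lemma polys_belowI: "degree A < k \<Longrightarrow> A \<in> polys_below k"
  by (auto simp: polys_below_def coeff_eq_0)

lemma polys_below_iff: "A \<in> polys_below k \<longleftrightarrow> A = 0 \<or> degree A < k"
proof
  assume *: "A \<in> polys_below k"
  show "A = 0 \<or> degree A < k"
  proof (rule ccontr)
    assume "\<not> (A = 0 \<or> degree A < k)"
    then have "A \<noteq> 0" "lead_coeff A = 0"
      using * by (auto simp: polys_below_def)
    then show False by simp
  qed
qed (auto simp: polys_below_def coeff_eq_0)

lemma polys_below_0 [simp]: "polys_below 0 = {0}"
  by (auto simp: polys_below_iff)

lemma zero_in_polys_below [simp]: "0 \<in> polys_below k"
  by (simp add: polys_below_def)

lemma polys_below_add: "A \<in> polys_below k \<Longrightarrow> B \<in> polys_below k \<Longrightarrow> A + B \<in> polys_below k"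
  by (simp add: polys_below_def)

lemma polys_below_diff:
  "A \<in> polys_below k \<Longrightarrow> B \<in> polys_below k \<Longrightarrow> A - (B :: 'a::ab_group_add poly) \<in> polys_below k"
  by (simp add: polys_below_def)

lemma polys_below_uminus:
  "A \<in> polys_below k \<Longrightarrow> - (A :: 'a::ab_group_add poly) \<in> polys_below k"
  by (simp add: polys_below_def)

lemma polys_below_smult: "A \<in> polys_below k \<Longrightarrow> smult c A \<in> polys_below k"
  by (simp add: polys_below_def)

lemma polys_below_sum:
  "(\<And>x. x \<in> X \<Longrightarrow> f x \<in> polys_below k) \<Longrightarrow> (\<Sum>x\<in>X. f x) \<in> polys_below k"
  by (simp add: polys_below_def coeff_sum)

lemma polys_below_mono: "k \<le> l \<Longrightarrow> A \<in> polys_below k \<Longrightarrow> A \<in> polys_below l"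
  by (auto simp: polys_below_def)

lemma polys_below_Suc: "polys_below (Suc k) = (\<lambda>(c, A). pCons c A) ` (UNIV \<times> polys_below k)"
proof (intro equalityI subsetI)
  fix A :: "'a poly" assume A: "A \<in> polys_below (Suc k)"
  obtain c B where "A = pCons c B" by (rule pCons_cases)
  with A have "B \<in> polys_below k" by (auto simp: polys_below_def)
  then show "A \<in> (\<lambda>(c, A). pCons c A) ` (UNIV \<times> polys_below k)"
    using \<open>A = pCons c B\<close> by auto
qed (auto simp: polys_below_def coeff_pCons split: nat.split)

lemma finite_polys_below [simp]: "finite (polys_below k :: 'a::{zero,finite} poly set)"
  by (induction k) (auto simp: polys_below_Suc)

lemma card_polys_below: "card (polys_below k :: 'a::{zero,finite} poly set) = CARD('a) ^ k"
proof (induction k)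
  case (Suc k)
  have "inj_on (\<lambda>(c, A). pCons c A) (UNIV \<times> (polys_below k :: 'a poly set))"
    by (auto simp: inj_on_def)
  then show ?case
    by (simp add: polys_below_Suc card_image card_cartesian_product Suc)
qed simp

lemma monic_polys_eq: "monic_polys k = (\<lambda>A. monom 1 k + A) ` polys_below k"
proof (intro equalityI subsetI)
  fix A :: "'a poly" assume A: "A \<in> monic_polys k"
  then have "A - monom 1 k \<in> polys_below k"
    by (auto simp: polys_below_def monic_polys_def coeff_eq_0 not_less)
  then show "A \<in> (\<lambda>A. monom 1 k + A) ` polys_below k"
    by (intro image_eqI[of _ _ "A - monom 1 k"]) auto
next
  fix A :: "'a poly" assume "A \<in> (\<lambda>A. monom 1 k + A) ` polys_below k"
  then obtain B where B: "B \<in> polys_below k" "A = monom 1 k + B" by auto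
  have "coeff A k = 1"
    using B by (auto simp: polys_below_def)
  moreover have "degree A \<le> k"
    by (rule degree_le) (use B in \<open>auto simp: polys_below_def\<close>)
  ultimately have "degree A = k"
    by (intro antisym le_degree) auto
  then show "A \<in> monic_polys k"
    using \<open>coeff A k = 1\<close> by (simp add: monic_polys_def)
qed

lemma card_monic_polys: "card (monic_polys k :: 'a::{field,finite} poly set) = CARD('a) ^ k"
  by (simp add: monic_polys_eq card_image inj_on_def card_polys_below)

lemma sum_monic_polys:
  "(\<Sum>B\<in>monic_polys k. f B) = (\<Sum>A\<in>polys_below k. f (monom 1 k + A))"
  by (simp add: monic_polys_eq sum.reindex inj_on_def)

section \<open>Residues modulo an irreducible polynomial\<close>

text \<open>Elements of the residue field modulo P are represented throughout by the reduced
  polynomials in \<open>polys_below n\<close>.\<close>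

locale irreducible_modulus =
  fixes P :: "'a::{field,finite} poly" and n :: nat
  assumes P: "P \<in> monic_irreducibles n"
begin

lemma degree_P [simp]: "degree P = n"
  and lead_coeff_P: "coeff P n = 1"
  and irreducible_P: "irreducible P"
  using P by (auto simp: monic_irreducibles_def monic_polys_def)

lemma P_nonzero [simp]: "P \<noteq> 0"
  using irreducible_P by auto

lemma n_pos: "n > 0"
proof (rule ccontr)
  assume "\<not> n > 0"
  then have "P dvd 1"
    using is_unit_iff_degree[of P] by simp
  then show False
    using irreducible_P by (simp add: irreducible_def)
qed

lemma prime_elem_P: "prime_elem P"
  by (rule field_poly_irreducible_imp_prime) (rule irreducible_P)

lemma P_dvd_mult_iff: "P dvd A * B \<longleftrightarrow> P dvd A \<or> P dvd B"
  using prime_elem_P by (rule prime_elem_dvd_mult_iff)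

lemma P_dvd_power_iff: "k > 0 \<Longrightarrow> P dvd A ^ k \<longleftrightarrow> P dvd A"
  using prime_elem_P prime_elem_dvd_power_iff by blast

lemma P_dvd_cong: "[A = B] (mod P) \<Longrightarrow> P dvd A \<longleftrightarrow> P dvd B"
  by (simp add: cong_def dvd_eq_mod_eq_0)

lemma P_dvd_prod_imp: "finite X \<Longrightarrow> P dvd (\<Prod>x\<in>X. f x) \<Longrightarrow> \<exists>x\<in>X. P dvd f x"
proof (induction X rule: finite_induct)
  case empty
  then show ?case
    using irreducible_P by (simp add: irreducible_def)
qed (auto simp: P_dvd_mult_iff)

lemma P_not_dvd_one [simp]: "\<not> P dvd 1"
  using irreducible_P by (simp add: irreducible_def)

lemma P_dvd_below_iff: "A \<in> polys_below n \<Longrightarrow> P dvd A \<longleftrightarrow> A = 0"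
  using dvd_imp_degree_le[of P A] by (cases "A = 0") (auto simp: polys_below_iff)

lemma P_dvd_const_iff: "P dvd [:c:] \<longleftrightarrow> c = 0"
  using n_pos by (subst P_dvd_below_iff) (auto intro!: polys_belowI)

lemma mod_in_polys_below [simp]: "A mod P \<in> polys_below n"
  using degree_mod_less[of P A] by (auto simp: polys_below_iff)

lemma mod_eq_self: "A \<in> polys_below n \<Longrightarrow> A mod P = A"
  by (cases "A = 0") (auto simp: polys_below_iff mod_poly_less)

lemma below_cong_imp_eq:
  "A \<in> polys_below n \<Longrightarrow> B \<in> polys_below n \<Longrightarrow> [A = B] (mod P) \<Longrightarrow> A = B"
  by (simp add: cong_def mod_eq_self)

lemma inj_on_mult_mod:
  assumes "\<not> P dvd A"
  shows "inj_on (\<lambda>C. A * C mod P) (polys_below n)"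
proof (rule inj_onI)
  fix C D assume *: "C \<in> polys_below n" "D \<in> polys_below n" "A * C mod P = A * D mod P"
  then have "P dvd A * (C - D)"
    by (simp add: mod_eq_dvd_iff algebra_simps)
  then have "P dvd C - D"
    using assms by (simp add: P_dvd_mult_iff)
  then show "C = D"
    using * below_cong_imp_eq by (simp add: cong_iff_dvd_diff)
qed

lemma mult_mod_image:
  assumes "\<not> P dvd A"
  shows "(\<lambda>C. A * C mod P) ` polys_below n = polys_below n"
  by (rule endo_inj_surj) (use inj_on_mult_mod[OF assms] in auto)

lemma bij_betw_mult_mod:
  "\<not> P dvd A \<Longrightarrow> bij_betw (\<lambda>C. A * C mod P) (polys_below n) (polys_below n)"
  by (simp add: bij_betw_def inj_on_mult_mod mult_mod_image)

text \<open>Multiplication by A permutes the nonzero residues; compare their product before and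
  after.\<close>

lemma fermat:
  assumes "\<not> P dvd A"
  shows "[A ^ (CARD('a) ^ n - 1) = 1] (mod P)"
proof -
  let ?K = "polys_below n - {0::'a poly}"
  have "bij_betw (\<lambda>C. A * C mod P) (polys_below n - {0}) (polys_below n - {A * 0 mod P})"
    using bij_betw_mult_mod[OF assms] by (intro bij_betw_DiffI) auto
  then have bij: "bij_betw (\<lambda>C. A * C mod P) ?K ?K"
    by simp
  have "[(\<Prod>C\<in>?K. A * C) = (\<Prod>C\<in>?K. A * C mod P)] (mod P)"
    by (rule cong_prod) (simp add: cong_def)
  also have "(\<Prod>C\<in>?K. A * C mod P) = (\<Prod>C\<in>?K. C)"
    using bij by (rule prod.reindex_bij_betw)
  finally have "[A ^ (CARD('a) ^ n - 1) * (\<Prod>C\<in>?K. C) = 1 * (\<Prod>C\<in>?K. C)] (mod P)"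
    by (simp add: prod.distrib card_Diff_singleton card_polys_below)
  then have "P dvd (A ^ (CARD('a) ^ n - 1) - 1) * (\<Prod>C\<in>?K. C)"
    by (simp add: cong_iff_dvd_diff algebra_simps)
  moreover have "\<not> P dvd (\<Prod>C\<in>?K. C)"
    using P_dvd_prod_imp[of ?K "\<lambda>C. C"] P_dvd_below_iff by auto
  ultimately show ?thesis
    by (simp add: cong_iff_dvd_diff P_dvd_mult_iff)
qed

lemma fermat': "[A ^ (CARD('a) ^ n) = A] (mod P)"
proof (cases "P dvd A")
  case True
  then show ?thesis
    by (simp add: cong_iff_dvd_diff dvd_power_le dvd_diff P_dvd_power_iff)
next
  case False
  have "[A * A ^ (CARD('a) ^ n - 1) = A * 1] (mod P)"
    using fermat[OF False] by (rule cong_scalar_left)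
  then show ?thesis
    by (metis One_nat_def Suc_pred mult.right_neutral power_Suc zero_less_card_finite zero_less_power)
qed

text \<open>The root bound over the residue field, with coefficients lifted to polynomials. Division
  by X - r leaves the remainder \<open>poly G r\<close>, which P divides, and the quotient stays
  monic, so that the induction goes on.\<close>

lemma card_roots_mod_le:
  assumes "lead_coeff G = 1" "R \<subseteq> polys_below n" "\<And>r. r \<in> R \<Longrightarrow> P dvd poly G r"
  shows "card R \<le> degree G"
  using assms
proof (induction "degree G" arbitrary: G R)
  case 0
  obtain c where "G = [:c:]"
    using 0(1) by (metis degree_eq_zeroE)
  then have "poly G r = 1" for r
    using 0(2) by simp
  then have "R = {}"
    using 0(4) by auto
  then show ?case by simp
next
  case (Suc m)
  show ?case
  proof (cases "R = {}")
    case False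
    then obtain r where r: "r \<in> R" by blast
    define H where "H = synthetic_div G r"
    have G: "G = [:-r, 1:] * H + [:poly G r:]"
      unfolding H_def by (rule synthetic_div_correct'[symmetric])
    have deg: "degree H = m"
      using Suc(2) by (simp add: H_def degree_synthetic_div)
    have "coeff G (Suc m) = coeff H m"
      by (subst G) (simp add: coeff_eq_0 deg coeff_pCons)
    then have lc: "lead_coeff H = 1"
      using Suc(2,3) deg by simp
    have "card (R - {r}) \<le> degree H"
    proof (rule Suc(1))
      fix s assume s: "s \<in> R - {r}"
      have "poly G s = (s - r) * poly H s + poly G r"
        by (subst G) (simp add: algebra_simps)
      moreover have "P dvd poly G s" "P dvd poly G r"
        using s r Suc(5) by auto
      ultimately have "P dvd (s - r) * poly H s"
        by (simp add: dvd_add_left_iff)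
      moreover have "\<not> P dvd s - r"
        using s r Suc(4) below_cong_imp_eq[of s r] by (auto simp: cong_iff_dvd_diff)
      ultimately show "P dvd poly H s"
        by (simp add: P_dvd_mult_iff)
    qed (use deg lc Suc(4) in auto)
    moreover have "finite R"
      using finite_subset[OF Suc(4)] by simp
    ultimately show ?thesis
      using r deg Suc(2) by (simp add: card_Diff_singleton)
  qed simp
qed

section \<open>The quadratic symbol modulo P and Euler's criterion\<close>

abbreviation chi :: "'a poly \<Rightarrow> int" where
  "chi A \<equiv> quad_symbol A P"

lemma chi_cong:
  assumes "[A = B] (mod P)"
  shows "chi A = chi B"
proof -
  have "P dvd A \<longleftrightarrow> P dvd B"
    using assms by (rule P_dvd_cong)
  moreover have "[C\<^sup>2 = A] (mod P) \<longleftrightarrow> [C\<^sup>2 = B] (mod P)" for C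
    using assms cong_trans cong_sym by blast
  ultimately show ?thesis
    by (simp add: quad_symbol_def)
qed

lemma chi_mod [simp]: "chi (A mod P) = chi A"
  by (rule chi_cong) (simp add: cong_def)

lemma chi_eq_0_iff: "chi A = 0 \<longleftrightarrow> P dvd A"
  by (simp add: quad_symbol_def)

lemma chi_0 [simp]: "chi 0 = 0"
  by (simp add: chi_eq_0_iff)

lemma chi_cases: "chi A = 0 \<or> chi A = 1 \<or> chi A = -1"
  by (simp add: quad_symbol_def)

lemma chi_power2: "\<not> P dvd A \<Longrightarrow> chi (A\<^sup>2) = 1"
  by (auto simp: quad_symbol_def P_dvd_power_iff intro: exI[of _ A])

end

locale odd_irreducible_modulus = irreducible_modulus +
  assumes odd_card: "odd CARD('a)"
begin

text \<open>A nonzero square has exactly the roots C and -C, which differ modulo P because 2 is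
  invertible for odd q.\<close>

lemma card_sqrt_mod:
  assumes A: "A \<in> polys_below n"
  shows "int (card {C \<in> polys_below n. C\<^sup>2 mod P = A}) = 1 + chi A"
proof -
  have eq: "C\<^sup>2 mod P = A \<longleftrightarrow> [C\<^sup>2 = A] (mod P)" for C
    using A by (simp add: cong_def mod_eq_self)
  consider "A = 0" | "A \<noteq> 0" "\<exists>C. [C\<^sup>2 = A] (mod P)" | "A \<noteq> 0" "\<not> (\<exists>C. [C\<^sup>2 = A] (mod P))"
    by blast
  then show ?thesis
  proof cases
    case 1
    then have "{C \<in> polys_below n. C\<^sup>2 mod P = A} = {0}"
      by (auto simp: eq cong_0_iff P_dvd_power_iff P_dvd_below_iff)
    then show ?thesis
      using 1 by simp
  next
    case 2
    then obtain C' where "[C'\<^sup>2 = A] (mod P)" by blast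
    define C where "C = C' mod P"
    have C: "C \<in> polys_below n" "[C\<^sup>2 = A] (mod P)"
      using \<open>[C'\<^sup>2 = A] (mod P)\<close> by (simp_all add: C_def cong_def power_mod)
    have nA: "\<not> P dvd A"
      using 2 A by (simp add: P_dvd_below_iff)
    then have nC: "\<not> P dvd C"
      using P_dvd_cong[OF C(2)] by (simp add: P_dvd_power_iff)
    have "\<not> P dvd C - (- C)"
    proof
      assume "P dvd C - (- C)"
      then have "P dvd [:2:] * C"
        by (simp add: numeral_poly smult_add_left[of 1 1, simplified])
      then show False
        using nC two_neq_zero[OF odd_card] by (auto simp: P_dvd_mult_iff P_dvd_const_iff simp del: mult_pCons_left)
    qed
    then have "C \<noteq> - C"
      by auto
    moreover have "{D \<in> polys_below n. D\<^sup>2 mod P = A} = {C, - C}"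
    proof (intro equalityI subsetI)
      fix D assume "D \<in> {D \<in> polys_below n. D\<^sup>2 mod P = A}"
      then have D: "D \<in> polys_below n" "[D\<^sup>2 = C\<^sup>2] (mod P)"
        using C(2) cong_sym cong_trans by (auto simp: eq) blast
      then have "P dvd (D - C) * (D - (- C))"
        by (simp add: cong_iff_dvd_diff power2_eq_square algebra_simps)
      then have "[D = C] (mod P) \<or> [D = - C] (mod P)"
        unfolding P_dvd_mult_iff cong_iff_dvd_diff .
      then show "D \<in> {C, - C}"
        using D(1) C(1) below_cong_imp_eq polys_below_uminus by blast
    next
      fix D assume "D \<in> {C, - C}"
      then show "D \<in> {D \<in> polys_below n. D\<^sup>2 mod P = A}"
        using C by (auto simp: eq polys_below_uminus)
    qed
    ultimately have "card {D \<in> polys_below n. D\<^sup>2 mod P = A} = 2"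
      by simp
    moreover have "chi A = 1"
      using 2 nA by (simp add: quad_symbol_def)
    ultimately show ?thesis
      by simp
  next
    case 3
    then have "{C \<in> polys_below n. C\<^sup>2 mod P = A} = {}"
      by (auto simp: eq)
    moreover have "chi A = -1"
      using 3 A by (simp add: quad_symbol_def P_dvd_below_iff)
    ultimately show ?thesis
      by simp
  qed
qed

text \<open>Group the C by their square and apply \<open>card_sqrt_mod\<close>. With f = 1 this
  yields \<open>sum_chi\<close>; with f a function of \<open>lam\<close> it later turns a Gauss sum
  into a sum over a quadratic form.\<close>

lemma sum_over_squares:
  fixes f :: "'a poly \<Rightarrow> int"
  shows "(\<Sum>C\<in>polys_below n. f (C\<^sup>2 mod P)) = (\<Sum>A\<in>polys_below n. (1 + chi A) * f A)"
proof -
  have "(\<Sum>C\<in>polys_below n. f (C\<^sup>2 mod P)) =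
      (\<Sum>A\<in>polys_below n. \<Sum>C | C \<in> polys_below n \<and> C\<^sup>2 mod P = A. f (C\<^sup>2 mod P))"
    by (rule sum.group[symmetric]) auto
  also have "\<dots> = (\<Sum>A\<in>polys_below n. (1 + chi A) * f A)"
  proof (rule sum.cong)
    fix A :: "'a poly" assume A: "A \<in> polys_below n"
    have "(\<Sum>C | C \<in> polys_below n \<and> C\<^sup>2 mod P = A. f (C\<^sup>2 mod P)) =
        (\<Sum>C | C \<in> polys_below n \<and> C\<^sup>2 mod P = A. f A)"
      by (rule sum.cong) auto
    then show "(\<Sum>C | C \<in> polys_below n \<and> C\<^sup>2 mod P = A. f (C\<^sup>2 mod P)) = (1 + chi A) * f A"
      using card_sqrt_mod[OF A] by simp
  qed simp
  finally show ?thesis .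
qed

lemma sum_chi: "(\<Sum>A\<in>polys_below n. chi A) = 0"
  using sum_over_squares[of "\<lambda>_. 1"] by (simp add: sum.distrib)

definition half :: nat where
  "half = (CARD('a) ^ n - 1) div 2"

lemma two_half: "2 * half = CARD('a) ^ n - 1"
  unfolding half_def using odd_card by (intro dvd_mult_div_cancel) simp

lemma half_pos: "half > 0"
proof -
  have "2 \<le> CARD('a) ^ n"
    using n_pos card_field_ge_2[where 'a = 'a]
    using self_le_power[of "CARD('a)" n] by linarith
  then show ?thesis
    using two_half by linarith
qed

lemma chi_eq_1_imp: 
  assumes "chi A = 1"
  shows "[A ^ half = 1] (mod P)"
proof -
  have nA: "\<not> P dvd A"
    using assms by (auto simp: quad_symbol_def)
  obtain C where C: "[C\<^sup>2 = A] (mod P)"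
    using assms by (auto simp: quad_symbol_def split: if_splits)
  have "\<not> P dvd C"
    using P_dvd_cong[OF C] nA by (simp add: P_dvd_power_iff)
  then have "[(C\<^sup>2) ^ half = 1] (mod P)"
    using fermat[of C] by (simp add: two_half flip: power_mult)
  moreover have "[(C\<^sup>2) ^ half = A ^ half] (mod P)"
    using C by (rule cong_pow)
  ultimately show ?thesis
    using cong_sym cong_trans by blast
qed

text \<open>For nonzero A the value \<open>1 + chi A\<close> is 2 or 0, and the values of
  \<open>chi\<close> sum to zero.\<close>

lemma card_chi_eq_1: "card {A \<in> polys_below n. chi A = 1} = half"
proof -
  let ?K = "polys_below n - {0 :: 'a poly}"
  let ?R = "{A \<in> polys_below n. chi A = 1}"
  have "(\<Sum>A\<in>?K. 1 + chi A) = (\<Sum>A\<in>?K. if chi A = 1 then 2 else 0)"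
  proof (rule sum.cong)
    fix A assume "A \<in> ?K"
    then have "chi A \<noteq> 0"
      by (simp add: chi_eq_0_iff P_dvd_below_iff)
    then show "1 + chi A = (if chi A = 1 then 2 else 0)"
      using chi_cases[of A] by auto
  qed simp
  also have "\<dots> = (\<Sum>A\<in>?R. 2)"
    by (rule sum.mono_neutral_cong_right) auto
  also have "(\<Sum>A\<in>?K. 1 + chi A) = int (card ?K) + (\<Sum>A\<in>?K. chi A)"
    by (simp add: sum.distrib)
  also have "(\<Sum>A\<in>?K. chi A) = (\<Sum>A\<in>polys_below n. chi A)"
    by (rule sum.mono_neutral_left) auto
  finally have "2 * card ?R = card ?K"
    unfolding sum_chi by simp
  also have "\<dots> = 2 * half"
    by (simp add: two_half card_Diff_singleton card_polys_below)
  finally show ?thesis by simp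
qed

text \<open>The residues of symbol 1 already exhaust the possible roots of
  \<open>X ^ half - 1\<close>, so the power of A is not 1. Its square is 1 by \<open>fermat\<close>,
  which leaves -1.\<close>

lemma chi_eq_neg1_imp:
  assumes "chi A = -1"
  shows "[A ^ half = -1] (mod P)"
proof -
  have nA: "\<not> P dvd A"
    using assms by (auto simp: quad_symbol_def)
  have "\<not> [A ^ half = 1] (mod P)"
  proof
    assume *: "[A ^ half = 1] (mod P)"
    let ?R = "{A \<in> polys_below n. chi A = 1}"
    define G :: "'a poly poly" where "G = monom 1 half + [:-1:]"
    have deg: "degree G = half"
      using half_pos unfolding G_def by (subst degree_add_eq_left) (auto simp: degree_monom_eq)
    have "card (insert (A mod P) ?R) \<le> degree G"
    proof (rule card_roots_mod_le)
      show "lead_coeff G = 1"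
        using half_pos unfolding deg by (simp add: G_def coeff_pCons split: nat.split)
      fix r assume r: "r \<in> insert (A mod P) ?R"
      then have "[r ^ half = 1] (mod P)"
      proof
        assume "r = A mod P"
        then show ?thesis
          using * by (simp add: cong_def power_mod)
      qed (use chi_eq_1_imp in auto)
      then show "P dvd poly G r"
        by (simp add: G_def poly_monom cong_iff_dvd_diff)
    qed auto
    moreover have "A mod P \<notin> ?R"
      using assms by simp
    moreover have "finite ?R"
      by simp
    ultimately show False
      using card_chi_eq_1 deg by simp
  qed
  moreover have "[(A ^ half)\<^sup>2 = 1] (mod P)"
    using fermat[OF nA] unfolding two_half[symmetric] by (simp add: mult.commute flip: power_mult)
  then have "P dvd (A ^ half - 1) * (A ^ half - (-1))"
    by (simp add: cong_iff_dvd_diff power2_eq_square algebra_simps)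
  ultimately show ?thesis
    unfolding P_dvd_mult_iff cong_iff_dvd_diff by blast
qed

lemma euler_criterion: "[A ^ half = of_int (chi A)] (mod P)"
proof (cases "P dvd A")
  case True
  then show ?thesis
    using half_pos by (simp add: cong_0_iff P_dvd_power_iff iffD2[OF chi_eq_0_iff])
next
  case False
  then show ?thesis
    using chi_cases[of A] chi_eq_1_imp[of A] chi_eq_neg1_imp[of A] by (auto simp: chi_eq_0_iff)
qed

text \<open>Different values in {0, 1, -1} differ by 1 or 2 up to sign, which is nonzero in a field
  of odd order. So a congruence modulo P determines the integer symbol, and multiplicativity follows
  from that of powers.\<close>

lemma chi_eqI:
  assumes "[A ^ half = of_int e] (mod P)" "e \<in> {0, 1, -1}"
  shows "chi A = e"
proof (rule ccontr)
  assume ne: "chi A \<noteq> e"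
  have "[of_int (chi A) = (of_int e :: 'a poly)] (mod P)"
    using euler_criterion[of A] assms(1) cong_sym cong_trans by blast
  then have "P dvd of_int (chi A - e)"
    by (simp add: cong_iff_dvd_diff)
  then have "P dvd [:of_int (chi A - e):]"
    by (simp only: of_int_poly)
  then have *: "of_int (chi A - e) = (0 :: 'a)"
    by (simp only: P_dvd_const_iff)
  consider "chi A - e = 1" | "chi A - e = -1" | "chi A - e = 2" | "chi A - e = -2"
    using ne assms(2) chi_cases[of A] by auto
  then show False
    by cases (use * two_neq_zero[OF odd_card] in \<open>simp_all del: of_int_diff\<close>)
qed

lemma chi_mult: "chi (A * B) = chi A * chi B"
proof (rule chi_eqI)
  show "[(A * B) ^ half = of_int (chi A * chi B)] (mod P)"
    using cong_mult[OF euler_criterion euler_criterion, of A B] by (simp add: power_mult_distrib)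
qed (use chi_cases[of A] chi_cases[of B] in auto)

end

section \<open>Counting irreducible polynomials\<close>

lemma monic_irreducible_dvd_imp_eq:
  assumes P: "P \<in> monic_irreducibles m" and R: "R \<in> monic_irreducibles n" and "P dvd R"
  shows "P = R"
proof -
  obtain C where C: "R = P * C"
    using \<open>P dvd R\<close> by blast
  interpret P: irreducible_modulus P m by unfold_locales (rule P)
  interpret R: irreducible_modulus R n by unfold_locales (rule R)
  have "\<not> is_unit P"
    using P.irreducible_P by (simp add: irreducible_def)
  then have "is_unit C"
    using irreducibleD[OF R.irreducible_P C] by blast
  then obtain c where c: "C = [:c:]"
    by (auto simp: is_unit_poly_iff)
  have "coeff R n = c * coeff P n"
    by (simp add: C c)
  moreover have "c \<noteq> 0"
    using C c R.P_nonzero by auto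
  then have "m = n"
    using P.degree_P R.degree_P C c by (auto simp: degree_smult_eq)
  ultimately have "c = 1"
    using P.lead_coeff_P R.lead_coeff_P by simp
  then show ?thesis
    by (simp add: C c one_pCons)
qed

lemma prod_monic_irreducibles_dvd:
  assumes "finite X" "\<And>P. P \<in> X \<Longrightarrow> P \<in> monic_irreducibles (degree P)" "\<And>P. P \<in> X \<Longrightarrow> P dvd F"
  shows "\<Prod>X dvd F"
  using assms
proof (induction X rule: finite_induct)
  case (insert P X)
  obtain d where "P \<in> monic_irreducibles d"
    using insert by auto
  then interpret irreducible_modulus P d
    by unfold_locales
  have "\<Prod>X dvd F"
    using insert by auto
  then obtain H where H: "F = \<Prod>X * H"
    by blast
  have "\<not> P dvd \<Prod>X"
  proof
    assume "P dvd \<Prod>X"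
    then obtain R where "R \<in> X" "P dvd R"
      using P_dvd_prod_imp[OF \<open>finite X\<close>, of "\<lambda>x. x"] by auto
    then have "P = R"
      using insert(4) by (intro monic_irreducible_dvd_imp_eq[OF P]) auto
    then show False
      using \<open>R \<in> X\<close> insert(2) by simp
  qed
  then have "P dvd H"
    using insert(5)[of P] by (simp add: H P_dvd_mult_iff)
  then show ?case
    using insert(1,2) mult_dvd_mono[of P H "\<Prod>X" "\<Prod>X"] by (simp add: H mult_ac)
qed simp

text \<open>Distinct monic irreducibles are coprime, so their product divides F. Both the upper
  bound on \<open>prime_count\<close> and the count in Stepanov's method rest on this.\<close>

lemma card_monic_irreducible_divisors_le:
  assumes "X \<subseteq> monic_irreducibles n" "\<And>P. P \<in> X \<Longrightarrow> P dvd F" "F \<noteq> (0 :: 'a::{field,finite} poly)"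
  shows "n * card X \<le> degree F"
proof -
  have fin: "finite X"
    using assms(1) finite_monic_irreducibles finite_subset by blast
  have deg: "degree P = n" "P \<noteq> 0" if "P \<in> X" for P
    using assms(1) that by (auto simp: monic_irreducibles_def monic_polys_def)
  have "\<Prod>X dvd F"
    using assms fin deg by (intro prod_monic_irreducibles_dvd) auto
  then have "degree (\<Prod>X) \<le> degree F"
    using assms(3) by (rule dvd_imp_degree_le)
  moreover have "degree (\<Prod>X) = (\<Sum>P\<in>X. degree P)"
    using deg by (intro degree_prod_eq_sum_degree) auto
  ultimately show ?thesis
    using deg by (simp add: mult.commute)
qed

lemma exists_monic_irreducible_divisor:
  fixes G :: "'a::{field,finite} poly"
  assumes "degree G > 0"
  shows "\<exists>P. P \<in> monic_irreducibles (degree P) \<and> P dvd G"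
  using assms
proof (induction "degree G" arbitrary: G rule: less_induct)
  case less
  have [simp]: "G \<noteq> 0"
    using less.prems by auto
  show ?case
  proof (cases "irreducible G")
    case True
    define c where "c = inverse (lead_coeff G)"
    have c: "c \<noteq> 0" "c * lead_coeff G = 1"
      by (auto simp: c_def)
    have "smult c G = [:c:] * G"
      by simp
    moreover have "is_unit [:c:]"
      using c by (simp add: is_unit_const_poly_iff dvd_field_iff)
    ultimately have "irreducible (smult c G)"
      using True by (simp only: irreducible_mult_unit_left)
    then have "smult c G \<in> monic_irreducibles (degree (smult c G))"
      using c by (simp add: monic_irreducibles_def monic_polys_def)
    moreover have "smult c G dvd G"
      using c by (simp add: smult_dvd_iff)
    ultimately show ?thesis by blast
  next
    case False
    have "\<not> is_unit G"
      using less.prems by (simp add: is_unit_iff_degree)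
    with False obtain A B where AB: "G = A * B" "\<not> is_unit A" "\<not> is_unit B"
      by (auto simp: irreducible_def)
    then have "A \<noteq> 0" "B \<noteq> 0"
      using \<open>G \<noteq> 0\<close> by auto
    then have "degree A > 0" "degree B > 0" "degree G = degree A + degree B"
      using AB by (auto simp: is_unit_iff_degree degree_mult_eq)
    then obtain P where "P \<in> monic_irreducibles (degree P)" "P dvd A"
      using less.hyps[of A] by auto
    then show ?thesis
      using AB(1) dvd_mult2 by blast
  qed
qed

section \<open>The irreducible factors of x ^ (q ^ N) - x\<close>

definition frobenius_minus_x :: "nat \<Rightarrow> 'a::{field,finite} poly" where
  "frobenius_minus_x N = monom 1 (CARD('a) ^ N) - monom 1 1"

lemma degree_frobenius_minus_x:
  assumes "N > 0"
  shows "degree (frobenius_minus_x N :: 'a::{field,finite} poly) = CARD('a) ^ N"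
proof -
  have "N < CARD('a) ^ N"
    using card_field_ge_2[where 'a = 'a] by (intro less_exp[THEN less_le_trans] power_mono) auto
  then have "1 < CARD('a) ^ N"
    using assms by linarith
  then show ?thesis
    unfolding frobenius_minus_x_def diff_conv_add_uminus
    by (subst degree_add_eq_left) (auto simp: degree_monom_eq)
qed

lemma frobenius_minus_x_nonzero:
  assumes "N > 0"
  shows "frobenius_minus_x N \<noteq> (0 :: 'a::{field,finite} poly)"
  using degree_frobenius_minus_x[OF assms, where 'a = 'a] by auto

lemma pderiv_frobenius_minus_x: "N > 0 \<Longrightarrow> pderiv (frobenius_minus_x N) = (- 1 :: 'a::{field,finite} poly)"
  by (simp add: frobenius_minus_x_def pderiv_diff pderiv_monom of_nat_card_field power_0_left
      monom_0 one_pCons)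

lemma cong_pcompose:
  fixes A :: "'a::{field,finite} poly"
  assumes "[B = C] (mod P)"
  shows "[pcompose A B = pcompose A C] (mod P)"
proof (induction A)
  case (pCons a A)
  then show ?case
    unfolding pcompose_pCons by (intro cong_add cong_mult assms) auto
qed simp

context irreducible_modulus
begin

lemma dvd_frobenius_minus_x: "P dvd frobenius_minus_x n"
  using fermat'[of "monom 1 1"] by (simp add: frobenius_minus_x_def cong_iff_dvd_diff monom_power)

text \<open>A double factor would also divide the derivative, which is -1.\<close>

lemma square_not_dvd_frobenius_minus_x:
  assumes "N > 0"
  shows "\<not> P * P dvd frobenius_minus_x N"
proof
  assume "P * P dvd frobenius_minus_x N"
  then obtain H where "frobenius_minus_x N = P * (P * H)"
    by (auto simp: mult.assoc)
  then have "pderiv (frobenius_minus_x N) = P * (pderiv (P * H) + H * pderiv P)"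
    by (simp add: pderiv_mult algebra_simps)
  then have "P dvd pderiv (frobenius_minus_x N)"
    by simp
  then show False
    by (simp add: pderiv_frobenius_minus_x[OF assms])
qed

text \<open>The N-th iterate of Frobenius fixes all residues and the n-th one does so anyway, hence
  so does the r-th for r = N mod n. With 0 < r < n this would give X ^ (q ^ r) - X as many as q ^ n
  roots.\<close>

lemma degree_dvd_if_dvd_frobenius_minus_x:
  assumes "P dvd frobenius_minus_x N"
  shows "n dvd N"
proof (rule ccontr)
  let ?q = "CARD('a)"
  assume "\<not> n dvd N"
  define r where "r = N mod n"
  have r: "0 < r" "r < n"
    using \<open>\<not> n dvd N\<close> n_pos by (auto simp: r_def dvd_eq_mod_eq_0)
  have 1: "[A ^ (?q ^ N) = A] (mod P)" for A
  proof -
    have "[monom 1 (?q ^ N) = monom 1 1] (mod P)"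
      using assms by (simp add: frobenius_minus_x_def cong_iff_dvd_diff)
    then have "[pcompose A (monom 1 (?q ^ N)) = pcompose A (monom 1 1)] (mod P)"
      by (rule cong_pcompose)
    moreover have "pcompose A (monom 1 1) = A"
      using frobenius_eq_pcompose[of A 0] by simp
    ultimately show ?thesis
      by (simp add: frobenius_eq_pcompose)
  qed
  have 2: "[A ^ (?q ^ (n * k)) = A] (mod P)" for A k
  proof (induction k)
    case (Suc k)
    have "A ^ (?q ^ (n * Suc k)) = (A ^ (?q ^ (n * k))) ^ (?q ^ n)"
      by (simp add: power_add power_mult[symmetric] mult.commute)
    also have "[\<dots> = A ^ (?q ^ (n * k))] (mod P)"
      by (rule fermat')
    finally show ?case
      using Suc cong_trans by blast
  qed simp
  have 3: "[A ^ (?q ^ r) = A] (mod P)" for A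
  proof -
    have "?q ^ N = ?q ^ (n * (N div n)) * ?q ^ r"
      by (simp add: r_def flip: power_add)
    then have "A ^ (?q ^ N) = (A ^ (?q ^ (n * (N div n)))) ^ (?q ^ r)"
      by (simp add: power_mult)
    moreover have "[(A ^ (?q ^ (n * (N div n)))) ^ (?q ^ r) = A ^ (?q ^ r)] (mod P)"
      by (intro cong_pow 2)
    ultimately have "[A ^ (?q ^ N) = A ^ (?q ^ r)] (mod P)"
      by simp
    then show ?thesis
      using 1[of A] cong_sym cong_trans by blast
  qed
  have "1 < ?q ^ r"
    using r card_field_ge_2[where 'a = 'a] by (intro one_less_power) auto
  define G :: "'a poly poly" where "G = monom 1 (?q ^ r) + [:0, -1:]"
  have deg: "degree G = ?q ^ r"
    using \<open>1 < ?q ^ r\<close> unfolding G_def by (subst degree_add_eq_left) (auto simp: degree_monom_eq)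
  have "card (polys_below n :: 'a poly set) \<le> degree G"
  proof (rule card_roots_mod_le)
    show "lead_coeff G = 1"
      unfolding deg using \<open>1 < ?q ^ r\<close> by (simp add: G_def coeff_eq_0)
    show "P dvd poly G A" for A
      using 3[of A] by (simp add: G_def poly_monom cong_iff_dvd_diff)
  qed auto
  then have "?q ^ n \<le> ?q ^ r"
    by (simp add: card_polys_below deg)
  then show False
    using r card_field_ge_2[where 'a = 'a] by simp
qed

end

lemma prime_count_le: "n * prime_count TYPE('a::{field,finite}) n \<le> CARD('a) ^ n"
proof (cases "n = 0")
  case False
  have "n * card (monic_irreducibles n :: 'a poly set) \<le> degree (frobenius_minus_x n :: 'a poly)"
    using False frobenius_minus_x_nonzero
    by (intro card_monic_irreducible_divisors_le)
       (auto intro: irreducible_modulus.dvd_frobenius_minus_x irreducible_modulus.intro)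
  then show ?thesis
    using False by (simp add: prime_count_def degree_frobenius_minus_x)
qed simp

text \<open>Compare degrees in the squarefree factorization of x ^ (q ^ n) - x. The degrees of
  factors other than n are proper divisors of n, hence at most \<open>n div 2\<close>, and
  contribute no more than a geometric sum.\<close>

lemma prime_count_ge:
  assumes "n > 0"
  shows "CARD('a) ^ n \<le> n * prime_count TYPE('a::{field,finite}) n + 2 * CARD('a) ^ (n div 2)"
proof -
  let ?q = "CARD('a)"
  let ?F = "frobenius_minus_x n :: 'a poly"
  let ?I = "insert n {1..n div 2}"
  define X where "X = {P. P \<in> monic_irreducibles (degree P) \<and> P dvd ?F}"
  have X: "degree P \<in> ?I" if "P \<in> X" for P
  proof -
    obtain d where "P \<in> monic_irreducibles d"
      using \<open>P \<in> X\<close> unfolding X_def by blast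
    then interpret irreducible_modulus P d
      by unfold_locales
    have "d dvd n"
      using that by (intro degree_dvd_if_dvd_frobenius_minus_x) (simp add: X_def)
    then obtain k where k: "n = d * k" by blast
    show ?thesis
    proof (cases "k \<le> 1")
      case True
      then have "k = 1"
        using k assms by (cases k) auto
      then show ?thesis
        using k by simp
    next
      case False
      then have "d * 2 \<le> d * k"
        by (intro mult_le_mono2) simp
      then have "d \<le> n div 2"
        using k by linarith
      then show ?thesis
        using n_pos by simp
    qed
  qed
  have sub: "X \<subseteq> (\<Union>d\<in>?I. monic_irreducibles d)"
  proof
    fix P assume "P \<in> X"
    then show "P \<in> (\<Union>d\<in>?I. monic_irreducibles d)"
      using X[of P] by (intro UN_I[of "degree P"]) (simp_all add: X_def)
  qed
  have fin: "finite X"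
    by (rule finite_subset[OF sub]) (auto simp: finite_monic_irreducibles)
  have "\<Prod>X dvd ?F"
    using fin by (intro prod_monic_irreducibles_dvd) (auto simp: X_def)
  then obtain H where H: "?F = \<Prod>X * H" by blast
  have "H \<noteq> 0"
    using H frobenius_minus_x_nonzero[OF assms, where 'a = 'a] by auto
  \<comment> \<open>An irreducible factor of the cofactor would belong to X too and so occur
    twice.\<close>
  have "degree H = 0"
  proof (rule ccontr)
    assume "degree H \<noteq> 0"
    then obtain P where P: "P \<in> monic_irreducibles (degree P)" "P dvd H"
      using exists_monic_irreducible_divisor by blast
    have "P dvd ?F"
      unfolding H using P(2) by (rule dvd_mult)
    then have "P \<in> X"
      using P(1) unfolding X_def by blast
    then have "P dvd \<Prod>X"
      using fin by (intro dvd_prodI)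
    then have "P * P dvd ?F"
      unfolding H using P(2) by (rule mult_dvd_mono)
    then show False
      using irreducible_modulus.square_not_dvd_frobenius_minus_x[OF irreducible_modulus.intro[OF P(1)] assms]
      by blast
  qed
  have "?q ^ n = degree ?F"
    by (simp add: degree_frobenius_minus_x assms)
  also have "\<dots> = degree (\<Prod>X)"
  proof -
    have "\<Prod>X \<noteq> 0"
      using H frobenius_minus_x_nonzero[OF assms, where 'a = 'a] by auto
    then show ?thesis
      unfolding H using \<open>degree H = 0\<close> \<open>H \<noteq> 0\<close> by (simp add: degree_mult_eq)
  qed
  also have "\<dots> = (\<Sum>P\<in>X. degree P)"
  proof (rule degree_prod_eq_sum_degree, intro ballI)
    fix P assume "P \<in> X"
    then have "irreducible P"
      unfolding X_def monic_irreducibles_def by blast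
    then show "P \<noteq> 0"
      by auto
  qed
  also have "\<dots> \<le> (\<Sum>P\<in>(\<Union>d\<in>?I. monic_irreducibles d :: 'a poly set). degree P)"
    by (rule sum_mono2) (use sub in \<open>auto simp: finite_monic_irreducibles\<close>)
  also have "\<dots> = (\<Sum>d\<in>?I. \<Sum>P\<in>(monic_irreducibles d :: 'a poly set). degree P)"
    by (rule sum.UNION_disjoint)
       (auto simp: finite_monic_irreducibles, auto simp: monic_irreducibles_def monic_polys_def)
  also have "\<dots> = (\<Sum>d\<in>?I. d * prime_count TYPE('a) d)"
    by (intro sum.cong) (auto simp: monic_irreducibles_def monic_polys_def prime_count_def)
  also have "\<dots> = n * prime_count TYPE('a) n + (\<Sum>d=1..n div 2. d * prime_count TYPE('a) d)"
    using assms by (subst sum.insert) auto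
  also have "(\<Sum>d=1..n div 2. d * prime_count TYPE('a) d) \<le> (\<Sum>d=1..n div 2. ?q ^ d)"
    by (intro sum_mono prime_count_le)
  also have "(\<Sum>d=1..m. ?q ^ d) \<le> 2 * ?q ^ m" for m
  proof (induction m)
    case (Suc m)
    have "2 * ?q ^ m \<le> ?q ^ Suc m"
      using card_field_ge_2[where 'a = 'a] by simp
    moreover have "(\<Sum>d=1..Suc m. ?q ^ d) = (\<Sum>d=1..m. ?q ^ d) + ?q ^ Suc m"
      by simp
    ultimately show ?case
      using Suc by linarith
  qed simp
  finally show ?thesis by simp
qed

section \<open>Stepanov's method\<close>

text \<open>Descent on the degree of a: an irreducible factor of a also divides b, and its square
  cancels.\<close>

lemma square_if_mult_square_eq_square:
  fixes B :: "'a::{field,finite} poly"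
  assumes "B * a\<^sup>2 = b\<^sup>2" "a \<noteq> 0"
  shows "\<exists>c. B = c\<^sup>2"
  using assms
proof (induction "degree a" arbitrary: a b rule: less_induct)
  case less
  show ?case
  proof (cases "degree a = 0")
    case True
    then obtain c where c: "a = [:c:]" "c \<noteq> 0"
      using less.prems(2) by (metis degree_eq_zeroE pCons_0_0)
    have "([:inverse c:] * b)\<^sup>2 = B * ([:inverse c:] * [:c:])\<^sup>2"
      unfolding power_mult_distrib less.prems(1)[symmetric] c(1) by (simp only: mult_ac)
    then have "B = ([:inverse c:] * b)\<^sup>2"
      using c(2) by (simp flip: one_pCons)
    then show ?thesis by blast
  next
    case False
    then obtain P n where "P \<in> monic_irreducibles n" and dvd: "P dvd a"
      using exists_monic_irreducible_divisor by blast
    then interpret irreducible_modulus P n by unfold_locales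
    have "P dvd b\<^sup>2"
      unfolding less.prems(1)[symmetric] using dvd by (simp add: power2_eq_square)
    then have "P dvd b"
      by (simp add: P_dvd_power_iff)
    then obtain a' b' where ab: "a = P * a'" "b = P * b'"
      using dvd by (auto elim!: dvdE)
    then have "P\<^sup>2 * (B * a'\<^sup>2) = P\<^sup>2 * b'\<^sup>2"
      using less.prems(1) by (simp add: power_mult_distrib mult_ac)
    then have "B * a'\<^sup>2 = b'\<^sup>2"
      by simp
    moreover have "a' \<noteq> 0"
      using less.prems(2) ab by auto
    moreover have "degree a' < degree a"
      using ab(1) \<open>a' \<noteq> 0\<close> n_pos by (simp add: degree_mult_eq)
    ultimately show ?thesis
      using less.hyps by blast
  qed
qed

text \<open>Polynomials F(x, y) of degree below U in the inner variable x and below J in the outer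
  variable y. Evaluation at \<open>monom 1 W\<close> substitutes y = x ^ W.\<close>

definition bipolys :: "nat \<Rightarrow> nat \<Rightarrow> 'a::zero poly poly set" where
  "bipolys J U = {F. (\<forall>i. coeff F i \<in> polys_below U) \<and> (\<forall>i\<ge>J. coeff F i = 0)}"

lemma bipolys_0 [simp]: "bipolys 0 U = {0}"
  by (auto simp: bipolys_def poly_eq_iff)

lemma bipolys_Suc: "bipolys (Suc J) U = (\<lambda>(A, F). pCons A F) ` (polys_below U \<times> bipolys J U)"
proof (intro equalityI subsetI)
  fix G :: "'a poly poly" assume G: "G \<in> bipolys (Suc J) U"
  obtain A F where AF: "G = pCons A F" by (rule pCons_cases)
  have "A \<in> polys_below U"
    using G[unfolded bipolys_def] AF by (metis (mono_tags, lifting) coeff_pCons_0 mem_Collect_eq)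
  moreover have "coeff F i \<in> polys_below U" "i \<ge> J \<Longrightarrow> coeff F i = 0" for i
    using G AF by (auto simp: bipolys_def dest: spec[of _ "Suc i"])
  ultimately show "G \<in> (\<lambda>(A, F). pCons A F) ` (polys_below U \<times> bipolys J U)"
    using AF by (auto simp: bipolys_def)
qed (auto simp: bipolys_def coeff_pCons split: nat.split)

lemma card_bipolys: "card (bipolys J U :: 'a::{zero,finite} poly poly set) = CARD('a) ^ (U * J)"
proof (induction J)
  case (Suc J)
  have "inj_on (\<lambda>(A, F). pCons A F) (polys_below U \<times> (bipolys J U :: 'a poly poly set))"
    by (auto simp: inj_on_def)
  then show ?case
    by (simp add: bipolys_Suc card_image card_cartesian_product card_polys_below Suc power_add)
qed simp

lemma bipolys_diff:
  "F \<in> bipolys J U \<Longrightarrow> G \<in> bipolys J U \<Longrightarrow> F - G \<in> (bipolys J U :: 'a::ab_group_add poly poly set)"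
  by (simp add: bipolys_def polys_below_diff)

lemma poly_bipolys:
  assumes "F \<in> bipolys J U"
  shows "poly F x = (\<Sum>j<J. coeff F j * x ^ j)"
proof (cases "F = 0")
  case False
  then have "degree F < J"
    using assms by (auto simp: bipolys_def) (metis leading_coeff_0_iff not_less)
  then have "(\<Sum>j\<le>degree F. coeff F j * x ^ j) = (\<Sum>j<J. coeff F j * x ^ j)"
    by (intro sum.mono_neutral_cong_left) (auto simp: coeff_eq_0)
  then show ?thesis
    by (simp add: poly_altdef)
qed simp

text \<open>The coefficients are digits in base x ^ W: being of degree below W, the lowest one
  cannot cancel against a multiple of x ^ W.\<close>

lemma bipoly_eq_0_if_poly_monom_eq_0:
  fixes F :: "'a::{field,finite} poly poly"
  assumes "\<And>i. coeff F i \<in> polys_below W" "poly F (monom 1 W) = 0"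
  shows "F = 0"
  using assms
proof (induction F)
  case (pCons A F)
  have eq: "A + monom 1 W * poly F (monom 1 W) = 0"
    using pCons.prems(2) by simp
  have "A = 0 \<and> poly F (monom 1 W) = 0"
  proof (rule ccontr)
    assume *: "\<not> (A = 0 \<and> poly F (monom 1 W) = 0)"
    then have ne: "poly F (monom 1 W) \<noteq> 0"
      using eq by auto
    have "A = - (monom 1 W * poly F (monom 1 W))"
      using eq by (simp add: eq_neg_iff_add_eq_0)
    then have "degree A = W + degree (poly F (monom 1 W))" "A \<noteq> 0"
      using ne by (auto simp: degree_mult_eq degree_monom_eq)
    moreover have "A \<in> polys_below W"
      using pCons.prems(1)[of 0] by simp
    ultimately show False
      by (simp add: polys_below_iff)
  qed
  moreover have "coeff F i \<in> polys_below W" for i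
    using pCons.prems(1)[of "Suc i"] by simp
  ultimately show ?case
    using pCons.IH by simp
qed simp

lemma polys_below_mult:
  fixes A B :: "'a::idom poly"
  assumes "A \<in> polys_below k" "B \<in> polys_below l" "k + l \<le> Suc m"
  shows "A * B \<in> polys_below m"
  using assms degree_mult_le[of A B] by (cases "A = 0 \<or> B = 0") (auto simp: polys_below_iff)

text \<open>Since \<open>B ^ W = B(x ^ W)\<close>, a relation \<open>u(x, x ^ W) + B ^ ((W - 1) / 2) * v(x, x ^ W) = 0\<close> squares
  to \<open>B(x) * u(x, x ^ W)\<^sup>2 = B(x ^ W) * v(x, x ^ W)\<^sup>2\<close>. The degrees in \<open>x\<close> are so small that
  \<open>x ^ W\<close> may be replaced by an independent variable, and comparing leading coefficients with
  respect to it shows that \<open>B\<close> is a square.\<close>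

lemma stepanov_nonzero:
  fixes B :: "'a::{field,finite} poly" and F G :: "'a poly poly"
  assumes B: "lead_coeff B = 1" "\<nexists>C. B = C\<^sup>2" and odd: "odd CARD('a)"
    and W: "W = CARD('a) ^ t" "2 * U + degree B \<le> W"
    and FG: "F \<in> bipolys J U" "G \<in> bipolys J U"
    and zero: "poly F (monom 1 W) + B ^ ((W - 1) div 2) * poly G (monom 1 W) = 0"
  shows "F = 0 \<and> G = 0"
proof -
  let ?X = "monom 1 W :: 'a poly"
  \<comment> \<open>B written in the outer variable, so that substituting x ^ W gives
    \<open>B ^ W\<close>.\<close>
  define B' where "B' = map_poly (\<lambda>c. [:c:]) B"
  have coeff_B': "coeff B' i = [:coeff B i:]" for i
    by (simp add: B'_def coeff_map_poly)
  have deg_B': "degree B' = degree B"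
    by (simp add: B'_def degree_map_poly)
  have lc_B': "lead_coeff B' = 1"
    using B by (simp add: deg_B' coeff_B' one_pCons)
  have poly_B': "poly B' ?X = B ^ W"
    by (simp add: B'_def W(1) frobenius_eq_pcompose pcompose_altdef)
  have "W = 2 * ((W - 1) div 2) + 1"
    using odd by (auto simp: W(1) elim!: oddE)
  then have "B ^ W = (B ^ ((W - 1) div 2))\<^sup>2 * B"
    by (metis Suc_eq_plus1 mult.commute power_Suc power_mult)
  moreover have "poly F ?X = - (B ^ ((W - 1) div 2) * poly G ?X)"
    using zero by (simp add: eq_neg_iff_add_eq_0)
  ultimately have "B * (poly F ?X)\<^sup>2 - B ^ W * (poly G ?X)\<^sup>2 = 0"
    by (simp add: power_mult_distrib)
  then have "poly ([:B:] * F\<^sup>2 - B' * G\<^sup>2) ?X = 0"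
    by (simp add: poly_B')
  moreover have "coeff ([:B:] * F\<^sup>2 - B' * G\<^sup>2) i \<in> polys_below W" for i
  proof -
    have F2: "coeff (F\<^sup>2) j \<in> polys_below (2 * U)" for j
      unfolding power2_eq_square coeff_mult
      by (intro polys_below_sum polys_below_mult[of _ U _ U]) (use FG in \<open>auto simp: bipolys_def\<close>)
    have G2: "coeff (G\<^sup>2) j \<in> polys_below (2 * U)" for j
      unfolding power2_eq_square coeff_mult
      by (intro polys_below_sum polys_below_mult[of _ U _ U]) (use FG in \<open>auto simp: bipolys_def\<close>)
    have "B * coeff (F\<^sup>2) i \<in> polys_below W"
      by (rule polys_below_mult[OF _ F2, of _ "Suc (degree B)"]) (use W(2) in \<open>auto intro: polys_belowI\<close>)
    moreover have "coeff (B' * G\<^sup>2) i \<in> polys_below W"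
      unfolding coeff_mult coeff_B'
      by (intro polys_below_sum polys_below_mult[OF _ G2, of _ 1])
         (use W(2) in \<open>auto intro: polys_belowI\<close>)
    ultimately show ?thesis
      by (simp add: polys_below_diff)
  qed
  ultimately have "[:B:] * F\<^sup>2 - B' * G\<^sup>2 = 0"
    using bipoly_eq_0_if_poly_monom_eq_0 by blast
  then have eq: "[:B:] * F\<^sup>2 = B' * G\<^sup>2"
    by simp
  then have "lead_coeff ([:B:] * F\<^sup>2) = lead_coeff (B' * G\<^sup>2)"
    by simp
  then have "B * (lead_coeff F)\<^sup>2 = (lead_coeff G)\<^sup>2"
    unfolding lead_coeff_mult lead_coeff_power lc_B' by simp
  then have "lead_coeff F = 0"
    using square_if_mult_square_eq_square B(2) by blast
  moreover from this have "G = 0"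
    using eq lc_B' by auto
  ultimately show ?thesis
    by simp
qed

text \<open>For M * W = q ^ n this is the M-th power of F(x, x ^ W) reduced modulo P: the power
  turns x ^ (W * j) into x ^ (j * q ^ n), which is congruent to x ^ j. The reduced form has a far
  smaller degree than the power itself.\<close>

definition twisted_eval :: "nat \<Rightarrow> nat \<Rightarrow> 'a::{field,finite} poly poly \<Rightarrow> 'a poly" where
  "twisted_eval M J F = (\<Sum>j<J. coeff F j ^ M * monom 1 j)"

lemma twisted_eval_diff:
  "twisted_eval (CARD('a) ^ s) J (F - G) =
    twisted_eval (CARD('a) ^ s) J F - twisted_eval (CARD('a) ^ s) J (G :: 'a::{field,finite} poly poly)"
  by (simp add: twisted_eval_def frobenius_power_diff left_diff_distrib sum_subtractf)

lemma twisted_eval_in_polys_below: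
  fixes F :: "'a::{field,finite} poly poly"
  assumes "F \<in> bipolys J U"
  shows "twisted_eval M J F \<in> polys_below (M * U + J)"
  unfolding twisted_eval_def
proof (intro polys_below_sum polys_belowI)
  fix j assume j: "j \<in> {..<J}"
  have "degree (coeff F j) \<le> U"
  proof -
    have "coeff F j \<in> polys_below U"
      using assms by (simp add: bipolys_def)
    then show ?thesis
      by (auto simp: polys_below_iff)
  qed
  then have "degree (coeff F j ^ M) \<le> M * U"
    by (intro order_trans[OF degree_power_le]) (simp add: mult.commute)
  then show "degree (coeff F j ^ M * monom 1 j) < M * U + J"
    using degree_mult_le[of "coeff F j ^ M" "monom 1 j"] degree_monom_le[of "1 :: 'a" j] j by auto
qed

lemma (in irreducible_modulus) twisted_eval_cong:
  fixes F :: "'a poly poly"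
  assumes "s \<le> n" and F: "F \<in> bipolys J U"
  shows "[poly F (monom 1 (CARD('a) ^ (n - s))) ^ (CARD('a) ^ s) = twisted_eval (CARD('a) ^ s) J F] (mod P)"
  unfolding poly_bipolys[OF F] frobenius_power_sum twisted_eval_def
proof (intro cong_sum)
  fix j
  let ?X = "monom 1 1 :: 'a poly"
  have "CARD('a) ^ n = CARD('a) ^ (n - s) * CARD('a) ^ s"
    using assms(1) by (simp flip: power_add)
  then have "(monom 1 (CARD('a) ^ (n - s)) ^ j) ^ (CARD('a) ^ s) = (?X ^ j) ^ (CARD('a) ^ n)"
    by (simp add: monom_power mult_ac)
  also have "[\<dots> = ?X ^ j] (mod P)"
    by (rule fermat')
  finally have "[(monom 1 (CARD('a) ^ (n - s)) ^ j) ^ (CARD('a) ^ s) = monom 1 j] (mod P)"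
    by (simp add: monom_power)
  then show "[(coeff F j * monom 1 (CARD('a) ^ (n - s)) ^ j) ^ (CARD('a) ^ s)
      = coeff F j ^ (CARD('a) ^ s) * monom 1 j] (mod P)"
    unfolding power_mult_distrib by (rule cong_scalar_left)
qed

text \<open>Linear algebra by pigeonhole: the pairs (F, G) outnumber the possible values. The map is
  additive because M is a power of q, so the difference of two pairs with the same value is a
  nonzero element of the kernel.\<close>

lemma stepanov_exists:
  fixes B :: "'a::{field,finite} poly" and \<epsilon> :: int
  assumes "M = CARD('a) ^ s" "M * U + degree B * M + J < 2 * (U * J)" "J > 0"
  shows "\<exists>F\<in>bipolys J U. \<exists>G\<in>bipolys J U. (F, G) \<noteq> (0, 0) \<and>
    B ^ ((M - 1) div 2) * twisted_eval M J F + of_int \<epsilon> * twisted_eval M J G = 0"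
proof -
  let ?X = "bipolys J U \<times> bipolys J U :: ('a poly poly \<times> 'a poly poly) set"
  let ?K = "M * U + degree B * M + J"
  define H where "H = (\<lambda>(F, G). B ^ ((M - 1) div 2) * twisted_eval M J F + of_int \<epsilon> * twisted_eval M J G)"
  have "H ` ?X \<subseteq> polys_below ?K"
  proof safe
    fix F G :: "'a poly poly" assume FG: "F \<in> bipolys J U" "G \<in> bipolys J U"
    have "degree (B ^ ((M - 1) div 2)) \<le> degree B * ((M - 1) div 2)"
      by (rule degree_power_le)
    also have "\<dots> \<le> degree B * M"
      by (intro mult_le_mono2) simp
    finally have "B ^ ((M - 1) div 2) \<in> polys_below (Suc (degree B * M))"
      by (intro polys_belowI) simp
    then have "B ^ ((M - 1) div 2) * twisted_eval M J F \<in> polys_below ?K"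
      by (rule polys_below_mult[OF _ twisted_eval_in_polys_below[OF FG(1)]]) simp
    moreover have "of_int \<epsilon> * twisted_eval M J G \<in> polys_below ?K"
      unfolding of_int_poly using polys_below_smult[OF twisted_eval_in_polys_below[OF FG(2)]]
      by (auto intro!: polys_below_mono[of "M * U + J" ?K])
    ultimately show "H (F, G) \<in> polys_below ?K"
      by (simp add: H_def polys_below_add)
  qed
  then have "card (H ` ?X) \<le> CARD('a) ^ ?K"
    using card_mono[of "polys_below ?K :: 'a poly set"] by (simp add: card_polys_below)
  also have "\<dots> < CARD('a) ^ (2 * (U * J))"
    using assms(2) card_field_ge_2[where 'a = 'a] by (intro power_strict_increasing) auto
  also have "\<dots> = card ?X"
    by (simp add: card_cartesian_product card_bipolys mult_2 power_add)
  finally have "\<not> inj_on H ?X"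
    by (rule pigeonhole)
  then obtain F1 G1 F2 G2 where FG: "F1 \<in> bipolys J U" "G1 \<in> bipolys J U" "F2 \<in> bipolys J U"
      "G2 \<in> bipolys J U" "(F1, G1) \<noteq> (F2, G2)" "H (F1, G1) = H (F2, G2)"
    by (auto simp: inj_on_def)
  have "H (F1 - F2, G1 - G2) = H (F1, G1) - H (F2, G2)"
    by (simp add: H_def assms(1) twisted_eval_diff algebra_simps)
  then show ?thesis
    using FG by (intro bexI[of _ "F1 - F2"] bexI[of _ "G1 - G2"]) (auto simp: bipolys_diff H_def)
qed

text \<open>Where the symbol is \<epsilon>, \<open>B ^ half\<close> is congruent to \<epsilon>. The
  pair (F, G) is chosen such that this forces P to divide
  \<open>B ^ ((M - 1) div 2) * R ^ M\<close>, hence R. As R is not zero, its degree bounds the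
  number of these P.\<close>

lemma stepanov:
  fixes B :: "'a::{field,finite} poly" and \<epsilon> :: int
  assumes odd: "odd CARD('a)" and B: "lead_coeff B = 1" "\<nexists>C. B = C\<^sup>2" and deg: "degree B < n"
    and large: "4 * degree B + 4 \<le> CARD('a) ^ (n div 2)" and \<epsilon>: "\<epsilon> \<in> {1, -1}"
  shows "2 * n * card {P \<in> monic_irreducibles n. quad_symbol B P = \<epsilon>}
    \<le> CARD('a) ^ n + 11 * n * CARD('a) ^ (n - n div 2)"
proof -
  define d s where "d = degree B" and "s = n div 2"
  define M W where "M = CARD('a) ^ s" and "W = CARD('a) ^ (n - s)"
  have MW: "M * W = CARD('a) ^ n"
    by (simp add: M_def W_def s_def flip: power_add)
  have "M \<le> W"
    using card_field_ge_2[where 'a = 'a] by (simp add: M_def W_def s_def)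
  have "odd M" "odd W"
    using odd by (auto simp: M_def W_def)
  \<comment> \<open>U is as large as the condition 2 * U + d <= W of \<open>stepanov_nonzero\<close>
    permits. J exceeds M / 2 by enough for the 2 * U * J unknowns to outnumber the M * U + d * M + J
    conditions; its leading part M / 2 is the source of the one half in the final count.\<close>
  define U J where "U = (W - d) div 2" and "J = (M + 1) div 2 + 4 * d + 4"
  have M: "4 * d + 4 \<le> M"
    using large by (simp add: M_def d_def s_def)
  have J: "2 * J = M + 8 * d + 9"
    using \<open>odd M\<close> by (auto simp: J_def)
  have "d \<le> W" "2 * U \<le> W - d" "W - d \<le> 2 * U + 1"
    using M \<open>M \<le> W\<close> unfolding U_def by linarith+
  then have U: "2 * U + d \<le> W" "M \<le> 4 * U"
    using M \<open>M \<le> W\<close> by linarith+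
  have "M * U + d * M + J < 2 * (U * J)"
  proof -
    have "M * (8 * d + 9) \<le> 4 * U * (8 * d + 9)"
      using U(2) by (rule mult_le_mono1)
    then have "4 * (d * M) + 2 * M + M * (4 * d + 7) \<le> 4 * (U * (8 * d + 9))"
      by (simp add: algebra_simps)
    moreover have "4 * (4 * d + 7) \<le> M * (4 * d + 7)"
      using M by (intro mult_le_mono1) simp
    then have "16 * d + 28 \<le> M * (4 * d + 7)"
      by simp
    moreover have "4 * J = 2 * M + 16 * d + 18"
      using J by simp
    ultimately have "4 * (d * M) + 4 * J < 4 * (U * (8 * d + 9))"
      by linarith
    moreover have "2 * (U * J) = U * M + U * (8 * d + 9)"
      using J by (metis add.assoc distrib_left mult.left_commute)
    ultimately show ?thesis
      by (simp add: mult.commute)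
  qed
  then obtain F G where FG: "F \<in> bipolys J U" "G \<in> bipolys J U" "(F, G) \<noteq> (0, 0)"
    and zero: "B ^ ((M - 1) div 2) * twisted_eval M J F + of_int \<epsilon> * twisted_eval M J G = 0"
    using stepanov_exists[OF M_def, of U B J \<epsilon>] by (auto simp: d_def J_def)
  define R where "R = poly F (monom 1 W) + B ^ ((W - 1) div 2) * poly G (monom 1 W)"
  have "R \<noteq> 0"
    using stepanov_nonzero[OF B odd W_def _ FG(1,2)] U(1) FG(3) by (auto simp: R_def d_def)
  have "P dvd R" if irr: "P \<in> monic_irreducibles n" and eps: "quad_symbol B P = \<epsilon>" for P
  proof -
    interpret odd_irreducible_modulus P n
      by unfold_locales (use irr odd in auto)
    have "[R ^ M = twisted_eval M J F + (B ^ ((W - 1) div 2)) ^ M * twisted_eval M J G] (mod P)"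
      unfolding R_def M_def W_def frobenius_power_add power_mult_distrib
      by (intro cong_add cong_mult twisted_eval_cong) (use FG in \<open>auto simp: s_def\<close>)
    \<comment> \<open>The extra factor completes the exponent of B in front of the G term to (M * W
      - 1) / 2 = \<open>half\<close>, where Euler's criterion applies.\<close>
    then have "[B ^ ((M - 1) div 2) * R ^ M =
        B ^ ((M - 1) div 2) * (twisted_eval M J F + (B ^ ((W - 1) div 2)) ^ M * twisted_eval M J G)] (mod P)"
      by (rule cong_scalar_left)
    also have "B ^ ((M - 1) div 2) * (twisted_eval M J F + (B ^ ((W - 1) div 2)) ^ M * twisted_eval M J G)
        = B ^ ((M - 1) div 2) * twisted_eval M J F
        + B ^ ((M - 1) div 2 + (W - 1) div 2 * M) * twisted_eval M J G"
      by (simp add: algebra_simps power_add flip: power_mult)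
    also have "(M - 1) div 2 + (W - 1) div 2 * M = half"
    proof -
      obtain m w where "M = 2 * m + 1" "W = 2 * w + 1"
        using \<open>odd M\<close> \<open>odd W\<close> by (auto elim!: oddE)
      moreover have "2 * half = M * W - 1"
        by (simp add: two_half MW)
      ultimately show ?thesis
        by (simp add: algebra_simps)
    qed
    also have "[B ^ ((M - 1) div 2) * twisted_eval M J F + B ^ half * twisted_eval M J G
        = B ^ ((M - 1) div 2) * twisted_eval M J F + of_int \<epsilon> * twisted_eval M J G] (mod P)"
      using euler_criterion[of B] eps by (intro cong_add cong_mult) auto
    finally have "P dvd B ^ ((M - 1) div 2) * R ^ M"
      unfolding zero by (simp add: cong_0_iff)
    moreover have "\<not> P dvd B"
      using eps \<epsilon> by (auto simp: quad_symbol_def)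
    then have "\<not> P dvd B ^ ((M - 1) div 2)"
      by (cases "(M - 1) div 2") (auto simp: P_dvd_mult_iff P_dvd_power_iff simp del: power_Suc)
    ultimately show "P dvd R"
      using \<open>odd M\<close> by (auto simp: P_dvd_mult_iff P_dvd_power_iff odd_pos)
  qed
  then have "n * card {P \<in> monic_irreducibles n. quad_symbol B P = \<epsilon>} \<le> degree R"
    using \<open>R \<noteq> 0\<close> by (intro card_monic_irreducible_divisors_le) auto
  moreover have "R \<in> polys_below (W + W * J + d * W)"
  proof -
    have eval: "poly F (monom 1 W) \<in> polys_below (W + W * J)" if "F \<in> bipolys J U" for F :: "'a poly poly"
      unfolding poly_bipolys[OF that] monom_power power_one
    proof (intro polys_below_sum polys_below_mult[of _ U _ "Suc (W * J)"])
      fix j assume "j \<in> {..<J}"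
      then have "W * j \<le> W * J"
        by (intro mult_le_mono2) simp
      then show "monom 1 (W * j) \<in> (polys_below (Suc (W * J)) :: 'a poly set)"
        by (intro polys_belowI le_imp_less_Suc order_trans[OF degree_monom_le])
    qed (use that U(1) in \<open>auto simp: bipolys_def\<close>)
    have "degree (B ^ ((W - 1) div 2)) \<le> d * ((W - 1) div 2)"
      unfolding d_def by (rule degree_power_le)
    also have "\<dots> \<le> d * W"
      by (intro mult_le_mono2) simp
    finally have "B ^ ((W - 1) div 2) \<in> polys_below (Suc (d * W))"
      by (intro polys_belowI) simp
    then have "B ^ ((W - 1) div 2) * poly G (monom 1 W) \<in> polys_below (W + W * J + d * W)"
      by (rule polys_below_mult[OF _ eval[OF FG(2)]]) simp
    moreover have "poly F (monom 1 W) \<in> polys_below (W + W * J + d * W)"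
      by (rule polys_below_mono[OF _ eval[OF FG(1)]]) simp
    ultimately show ?thesis
      by (simp add: R_def polys_below_add)
  qed
  then have "degree R \<le> W + W * J + d * W"
    using \<open>R \<noteq> 0\<close> by (auto simp: polys_below_iff)
  ultimately have "2 * (n * card {P \<in> monic_irreducibles n. quad_symbol B P = \<epsilon>})
      \<le> 2 * W + W * (2 * J) + 2 * (d * W)"
    by simp
  also have "\<dots> = M * W + (10 * d + 11) * W"
    unfolding J by (simp add: algebra_simps)
  also have "\<dots> \<le> M * W + (11 * n) * W"
    using deg by (intro add_left_mono mult_le_mono1) (simp add: d_def)
  finally show ?thesis
    by (simp add: MW) (simp add: W_def s_def mult_ac)
qed

text \<open>Neither value 1 nor -1 is taken much more than q ^ n / (2 * n) times, while the two
  counts add up to nearly q ^ n / n by \<open>prime_count_ge\<close>. Hence they are close; 13 is 11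
  from \<open>stepanov\<close> plus 2 from \<open>prime_count_ge\<close>.\<close>

lemma stepanov_sum:
  fixes B :: "'a::{field,finite} poly"
  assumes odd: "odd CARD('a)" and B: "lead_coeff B = 1" "\<nexists>C. B = C\<^sup>2" and deg: "degree B < n"
    and large: "4 * degree B + 4 \<le> CARD('a) ^ (n div 2)"
  shows "\<bar>\<Sum>P\<in>monic_irreducibles n. quad_symbol B P\<bar> \<le> 13 * CARD('a) ^ (n - n div 2)"
proof -
  let ?S = "\<lambda>e :: int. {P \<in> monic_irreducibles n. quad_symbol B P = e}"
  define a b W where "a = card (?S 1)" and "b = card (?S (-1))" and "W = CARD('a) ^ (n - n div 2)"
  have fin: "finite (?S e)" for e
    using finite_monic_irreducibles finite_subset by (auto intro: finite_subset[OF _ finite_monic_irreducibles])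
  have ne: "quad_symbol B P \<noteq> 0" if "P \<in> monic_irreducibles n" for P
  proof -
    interpret irreducible_modulus P n by unfold_locales (rule that)
    have "B \<in> polys_below n" "B \<noteq> 0"
      using deg B(1) by (auto intro: polys_belowI)
    then show ?thesis
      by (simp add: chi_eq_0_iff P_dvd_below_iff)
  qed
  moreover have "quad_symbol B P \<in> {0, 1, -1}" for P
    by (simp add: quad_symbol_def)
  ultimately have un: "monic_irreducibles n = ?S 1 \<union> ?S (-1)"
    by blast
  have "(\<Sum>P\<in>monic_irreducibles n. quad_symbol B P)
      = (\<Sum>P\<in>?S 1. quad_symbol B P) + (\<Sum>P\<in>?S (-1). quad_symbol B P)"
    by (subst un, rule sum.union_disjoint) (use fin in auto)
  also have "\<dots> = int a - int b"
    by (simp add: a_def b_def)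
  finally have sum: "(\<Sum>P\<in>monic_irreducibles n. quad_symbol B P) = int a - int b" .
  have "prime_count TYPE('a) n = a + b"
    unfolding prime_count_def a_def b_def by (subst un, rule card_Un_disjoint) (use fin in auto)
  then have total: "CARD('a) ^ n \<le> n * a + n * b + 2 * CARD('a) ^ (n div 2)"
    using prime_count_ge[of n, where 'a = 'a] deg by (simp add: algebra_simps)
  have "CARD('a) ^ (n div 2) \<le> W"
    using card_field_ge_2[where 'a = 'a] by (simp add: W_def)
  moreover have "W \<le> n * W"
    using deg by simp
  moreover have "2 * (n * a) \<le> CARD('a) ^ n + 11 * (n * W)" "2 * (n * b) \<le> CARD('a) ^ n + 11 * (n * W)"
    using stepanov[OF assms, of 1] stepanov[OF assms, of "-1"]
    by (simp_all add: a_def b_def W_def mult.assoc)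
  ultimately have "n * a \<le> n * b + 13 * (n * W)" "n * b \<le> n * a + 13 * (n * W)"
    using total by linarith+
  then have "n * a \<le> n * (b + 13 * W)" "n * b \<le> n * (a + 13 * W)"
    by (simp_all add: algebra_simps)
  then have "a \<le> b + 13 * W" "b \<le> a + 13 * W"
    using deg by simp_all
  then show ?thesis
    unfolding sum W_def by linarith
qed

section \<open>The functional equation\<close>

text \<open>(q ^ n - 1) / 2 is (q - 1) / 2 times 1 + q + ... + q ^ (n - 1), and q-th powers fix c.
  Consequently the symbol of a constant modulo P depends only on the constant and the parity of
  n.\<close>

lemma power_half_field:
  fixes c :: "'a::{field,finite}"
  assumes "odd CARD('a)"
  shows "c ^ ((CARD('a) ^ n - 1) div 2) = (c ^ ((CARD('a) - 1) div 2)) ^ n"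
proof (induction n)
  case (Suc n)
  let ?q = "CARD('a)"
  obtain k where k: "?q = 2 * k + 1"
    using assms oddE by blast
  have "odd (?q ^ n)"
    using assms by simp
  then obtain l where l: "?q ^ n = 2 * l + 1"
    using oddE by blast
  have "?q ^ Suc n = 2 * (l * ?q + k) + 1"
    using k l by (simp add: algebra_simps)
  then have "(?q ^ Suc n - 1) div 2 = l * ?q + k"
    by simp
  moreover have "(?q ^ n - 1) div 2 = l" "(?q - 1) div 2 = k"
    using k l by simp_all
  ultimately show ?case
    using Suc by (simp add: power_add power_mult power_card_eq_self)
qed simp

lemma exists_half_power_neq_one:
  assumes "odd CARD('a::{field,finite})"
  shows "\<exists>c::'a. c \<noteq> 0 \<and> c ^ ((CARD('a) - 1) div 2) \<noteq> 1"
proof (rule ccontr)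
  let ?h = "(CARD('a) - 1) div 2"
  assume "\<not> ?thesis"
  then have *: "c ^ ?h = 1" if "c \<noteq> 0" for c :: 'a
    using that by blast
  have h: "CARD('a) - 1 = 2 * ?h" "CARD('a) \<ge> 2"
    using assms card_field_ge_2[where 'a = 'a] by simp_all
  define p :: "'a poly" where "p = monom 1 ?h + [:-1:]"
  have deg: "degree p = ?h"
    using h unfolding p_def by (subst degree_add_eq_left) (auto simp: degree_monom_eq)
  then have "p \<noteq> 0"
    using h by auto
  have "card (UNIV - {0::'a}) \<le> card {x. poly p x = 0}"
    using * by (intro card_mono) (auto simp: p_def poly_monom)
  also have "\<dots> \<le> ?h"
    using card_poly_roots_bound[OF \<open>p \<noteq> 0\<close>] deg by simp
  finally show False
    using h by (simp add: card_Diff_singleton)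
qed

text \<open>Orthogonality without additive characters: translating A by a multiple of v shifts
  \<open>f A\<close> by any prescribed constant and preserves the sum. Averaging over all shifts
  produces full sums of h.\<close>

lemma sum_functional_eq_0:
  fixes f :: "'a::{field,finite} poly \<Rightarrow> 'a" and h :: "'a \<Rightarrow> int"
  assumes add: "\<And>A B. f (A + B) = f A + f B" and smult: "\<And>c A. f (smult c A) = c * f A"
    and v: "v \<in> polys_below k" "f v \<noteq> 0" and h: "(\<Sum>a\<in>UNIV. h a) = 0"
  shows "(\<Sum>A\<in>polys_below k. h (c + f A)) = 0"
proof -
  let ?T = "\<Sum>A\<in>polys_below k. h (c + f A)"
  have shift: "(\<Sum>A\<in>polys_below k. h (c + f A + t)) = ?T" for t
    by (rule sum.reindex_bij_witness[of _ "\<lambda>A. A - smult (t / f v) v" "\<lambda>A. A + smult (t / f v) v"])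
       (use v in \<open>auto simp: add smult polys_below_add polys_below_diff polys_below_smult add.assoc\<close>)
  have "int CARD('a) * ?T = (\<Sum>t\<in>UNIV. \<Sum>A\<in>polys_below k. h (c + f A + t))"
    by (simp add: shift)
  also have "\<dots> = (\<Sum>A\<in>polys_below k. \<Sum>t\<in>UNIV. h (c + f A + t))"
    by (rule sum.swap)
  also have "\<dots> = (\<Sum>A\<in>(polys_below k :: 'a poly set). \<Sum>t\<in>UNIV. h t)"
    by (rule sum.cong[OF refl], rule sum.reindex_bij_witness[of _ "\<lambda>t. t - (c + f _)" "\<lambda>t. c + f _ + t"]) auto
  finally show ?thesis
    by (simp add: h)
qed

lemma sum_polys_below_Suc:
  fixes F :: "'a::{field,finite} poly \<Rightarrow> int"
  shows "(\<Sum>A\<in>polys_below (Suc k). F A) =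
    (\<Sum>A\<in>polys_below k. F A) + (\<Sum>c\<in>UNIV-{0}. \<Sum>B\<in>monic_polys k. F (smult c B))"
proof -
  have "(\<Sum>A\<in>polys_below (Suc k). F A)
      = (\<Sum>A\<in>polys_below k. F A) + (\<Sum>A\<in>polys_below (Suc k) - polys_below k. F A)"
    by (subst sum.subset_diff[of "polys_below k"]) (use polys_below_mono[of k "Suc k"] in auto)
  also have "(\<Sum>A\<in>polys_below (Suc k) - polys_below k. F A)
      = (\<Sum>(c, B)\<in>(UNIV - {0}) \<times> monic_polys k. F (smult c B))"
  proof -
    define i where "i = (\<lambda>(c, B :: 'a poly). smult c B)"
    define j where "j = (\<lambda>A :: 'a poly. (lead_coeff A, smult (inverse (lead_coeff A)) A))"
    show ?thesis
    proof (rule sum.reindex_bij_witness[of _ i j])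
      fix A :: "'a poly" assume "A \<in> polys_below (Suc k) - polys_below k"
      then have A: "A \<noteq> 0" "degree A = k"
        by (auto simp: polys_below_iff)
      then show "i (j A) = A" "j A \<in> (UNIV - {0}) \<times> monic_polys k"
        "(case j A of (c, B) \<Rightarrow> F (smult c B)) = F A"
        by (auto simp: monic_polys_def i_def j_def)
    next
      fix x :: "'a \<times> 'a poly" assume x: "x \<in> (UNIV - {0}) \<times> monic_polys k"
      obtain c B where "x = (c, B)" by fastforce
      moreover from this have "c \<noteq> 0" "coeff B (degree B) = 1" "degree B = k" "B \<noteq> 0"
        using x by (auto simp: monic_polys_def)
      ultimately show "j (i x) = x" "i x \<in> polys_below (Suc k) - polys_below k"
        by (auto simp: polys_below_iff i_def j_def)
    qed
  qed
  also have "\<dots> = (\<Sum>c\<in>UNIV-{0}. \<Sum>B\<in>monic_polys k. F (smult c B))"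
    by (simp add: sum.cartesian_product)
  finally show ?thesis .
qed

section \<open>Symbols of constants, Gauss sums and duality modulo P\<close>

context odd_irreducible_modulus
begin

lemma chi_const:
  assumes "c \<noteq> 0"
  shows "chi [:c:] = 1 \<longleftrightarrow> c ^ half = 1"
proof -
  have "P dvd [:c ^ half - 1:] \<longleftrightarrow> [[:c:] ^ half = 1] (mod P)"
    by (simp add: cong_iff_dvd_diff poly_const_pow one_pCons)
  then have "[[:c:] ^ half = 1] (mod P) \<longleftrightarrow> c ^ half = 1"
    by (simp add: P_dvd_const_iff)
  then show ?thesis
    using chi_eq_1_imp chi_eqI[of "[:c:]" 1] by auto
qed

lemma const_power_half: "c ^ half = (c ^ ((CARD('a) - 1) div 2)) ^ n" for c :: 'a
  unfolding half_def by (rule power_half_field[OF odd_card])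

lemma power_half_field_square:
  assumes "c \<noteq> (0 :: 'a)"
  shows "(c ^ ((CARD('a) - 1) div 2))\<^sup>2 = 1"
proof -
  have "c * c ^ (CARD('a) - 1) = c"
    using power_card_eq_self[of c] by (metis One_nat_def Suc_pred power_Suc zero_less_card_finite)
  then show ?thesis
    using assms odd_card by (simp flip: power_mult)
qed

lemma chi_const_even:
  assumes "even n" "c \<noteq> 0"
  shows "chi [:c:] = 1"
proof -
  obtain k where "n = 2 * k"
    using assms(1) by blast
  have "(c ^ ((CARD('a) - 1) div 2)) ^ n = ((c ^ ((CARD('a) - 1) div 2))\<^sup>2) ^ k"
    unfolding \<open>n = 2 * k\<close> by (rule power_mult)
  then have "c ^ half = 1"
    unfolding const_power_half power_half_field_square[OF assms(2)] by simp
  then show ?thesis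
    using assms(2) by (simp add: chi_const)
qed

text \<open>For odd n some constant has symbol -1; multiplication by it permutes the constants and
  negates the sum.\<close>

lemma sum_chi_const_odd:
  assumes "odd n"
  shows "(\<Sum>c\<in>UNIV. chi [:c:]) = 0"
proof -
  obtain c :: 'a where c: "c \<noteq> 0" "c ^ ((CARD('a) - 1) div 2) \<noteq> 1"
    using exists_half_power_neq_one[OF odd_card] by blast
  let ?e = "c ^ ((CARD('a) - 1) div 2)"
  obtain k where "n = 2 * k + 1"
    using assms oddE by blast
  then have "c ^ half = ?e ^ (2 * k + 1)"
    unfolding const_power_half by simp
  then have "c ^ half = ?e"
    by (simp only: power_add power_mult power_half_field_square[OF c(1)]) simp
  then have "chi [:c:] = -1"
    using c chi_const[of c] chi_cases[of "[:c:]"] by (auto simp: chi_eq_0_iff P_dvd_const_iff)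
  then have "chi [:c * a:] = - chi [:a:]" for a
    using chi_mult[of "[:c:]" "[:a:]"] by (simp add: mult.commute)
  moreover have "(\<Sum>a\<in>UNIV. chi [:a:]) = (\<Sum>a\<in>UNIV. chi [:c * a:])"
    by (rule sum.reindex_bij_witness[of _ "\<lambda>a. c * a" "\<lambda>a. a / c"]) (use c in auto)
  ultimately show ?thesis
    by (simp add: sum_negf)
qed

text \<open>By a formula of Euler this is the trace of \<open>A / P'\<close> from the residue field to the field of
  constants. Summation over \<open>polys_below m\<close> is dual to summation over \<open>polys_below (n - m)\<close> under
  the pairing \<open>lam (A * B)\<close>.\<close>

definition lam :: "'a poly \<Rightarrow> 'a" where
  "lam A = coeff (A mod P) (n - 1)"

lemma lam_mod [simp]: "lam (A mod P) = lam A"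
  by (simp add: lam_def)

lemma lam_add: "lam (A + B) = lam A + lam B"
  by (simp add: lam_def poly_mod_add_left)

lemma lam_smult: "lam (smult c A) = c * lam A"
  by (simp add: lam_def mod_smult_left)

lemma lam_below: "A \<in> polys_below n \<Longrightarrow> lam A = coeff A (n - 1)"
  by (simp add: lam_def mod_eq_self)

lemma lam_eq_0: "A \<in> polys_below (n - 1) \<Longrightarrow> lam A = 0"
  using polys_below_mono[of "n - 1" n A] by (auto simp: lam_below polys_below_def)

text \<open>The witness is the power of x that moves the leading coefficient of A to degree n - 1
  without any reduction modulo P.\<close>

lemma lam_witness:
  assumes "A \<in> polys_below n" "A \<notin> polys_below l" "l + m = n"
  shows "\<exists>v\<in>polys_below m. lam (A * v) \<noteq> 0"
proof -
  have A: "A \<noteq> 0" "l \<le> degree A" "degree A < n"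
    using assms by (auto simp: polys_below_iff)
  define v :: "'a poly" where "v = monom 1 (n - 1 - degree A)"
  have "degree v = n - 1 - degree A"
    by (simp add: v_def degree_monom_eq)
  then have v: "v \<in> polys_below m"
    using A assms(3) by (intro polys_belowI) auto
  have "A * v \<in> polys_below n"
    using A by (intro polys_below_mult[of _ "Suc (degree A)" _ "n - degree A"] polys_belowI)
      (auto simp: v_def degree_monom_eq)
  then have "lam (A * v) = coeff (A * v) (degree A + (n - 1 - degree A))"
    using A by (simp add: lam_below)
  also have "\<dots> = lead_coeff A"
    using A by (simp add: v_def mult.commute[of A] coeff_monom_mult)
  finally show ?thesis
    using v A by (intro bexI[of _ v]) auto
qed

lemma sum_h_lam_mult_eq_0:
  fixes h :: "'a \<Rightarrow> int"
  assumes "A \<in> polys_below n" "A \<notin> polys_below l" "l + m = n" "(\<Sum>a\<in>UNIV. h a) = 0"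
  shows "(\<Sum>B\<in>polys_below m. h (c + lam (A * B))) = 0"
proof -
  obtain v where "v \<in> polys_below m" "lam (A * v) \<noteq> 0"
    using lam_witness[OF assms(1-3)] by blast
  then show ?thesis
    using assms(4) by (intro sum_functional_eq_0) (auto simp: distrib_left lam_add lam_smult)
qed

text \<open>The Gauss sum of \<open>chi\<close>, with the integer kernel h in place of an additive
  character of the constants.\<close>

definition tau :: "('a \<Rightarrow> int) \<Rightarrow> int" where
  "tau h = (\<Sum>A\<in>polys_below n. chi A * h (lam A))"

text \<open>Substitute \<open>B * A\<close> for A, which permutes the residues; \<open>chi B\<close>
  is its own inverse.\<close>

lemma sum_chi_h_lam_mult:
  assumes "\<not> P dvd B"
  shows "(\<Sum>A\<in>polys_below n. chi A * h (lam (A * B))) = chi B * tau h"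
proof -
  have "chi B * chi B = 1"
    using assms chi_cases[of B] by (auto simp: chi_eq_0_iff)
  have "tau h = (\<Sum>A\<in>polys_below n. chi (B * A mod P) * h (lam (B * A mod P)))"
    unfolding tau_def by (rule sum.reindex_bij_betw[symmetric]) (rule bij_betw_mult_mod[OF assms])
  also have "\<dots> = chi B * (\<Sum>A\<in>polys_below n. chi A * h (lam (A * B)))"
    by (simp add: chi_mult sum_distrib_left mult_ac)
  finally have "chi B * tau h = (chi B * chi B) * (\<Sum>A\<in>polys_below n. chi A * h (lam (A * B)))"
    by (simp only: mult.assoc)
  then show ?thesis
    using \<open>chi B * chi B = 1\<close> by simp
qed

text \<open>The quadratic form \<open>lam (C\<^sup>2)\<close> vanishes on \<open>polys_below (n div 2)\<close>, a totally isotropic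
  subspace of largest possible dimension. This is what determines the sign of the Gauss sum.\<close>

lemma tau_eq:
  assumes h: "(\<Sum>a\<in>UNIV. h a) = 0" and s: "s = n div 2"
  shows "tau h = (\<Sum>C\<in>polys_below (n - s). h (lam (C\<^sup>2)))"
proof -
  \<comment> \<open>Since h composed with \<open>lam\<close> sums to zero, \<open>chi\<close> may be
    replaced by \<open>1 + chi\<close>, which turns the sum into one over squares.\<close>
  have "(\<Sum>A\<in>polys_below n. h (0 + lam (1 * A))) = 0"
    by (rule sum_h_lam_mult_eq_0[of 1 0]) (use n_pos h in \<open>auto intro: polys_belowI\<close>)
  then have "tau h = (\<Sum>A\<in>polys_below n. (1 + chi A) * h (lam A))"
    by (simp add: tau_def distrib_right sum.distrib)
  also have "\<dots> = (\<Sum>C\<in>polys_below n. h (lam (C\<^sup>2)))"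
    using sum_over_squares[of "\<lambda>A. h (lam A)"] by simp
  finally have tau: "tau h = (\<Sum>C\<in>polys_below n. h (lam (C\<^sup>2)))" .
  have D2: "lam (D\<^sup>2) = 0" if "D \<in> polys_below s" for D
    unfolding power2_eq_square using that s
    by (intro lam_eq_0 polys_below_mult[of _ s _ s]) auto
  \<comment> \<open>Average over translations by the isotropic subspace. The cross term 2 * C * D
    annihilates all C outside the orthogonal complement \<open>polys_below (n - s)\<close> and
    vanishes under \<open>lam\<close> for C inside it.\<close>
  have "int (CARD('a) ^ s) * tau h = (\<Sum>D\<in>(polys_below s :: 'a poly set). tau h)"
    by (simp add: card_polys_below)
  also have "\<dots> = (\<Sum>D\<in>polys_below s. \<Sum>C\<in>polys_below n. h (lam (C\<^sup>2) + lam (smult 2 C * D)))"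
  proof (rule sum.cong)
    fix D :: "'a poly" assume D: "D \<in> polys_below s"
    then have D': "D \<in> polys_below n"
      using s polys_below_mono[of s n] by auto
    have "tau h = (\<Sum>C\<in>polys_below n. h (lam ((C + D)\<^sup>2)))"
      unfolding tau
      by (rule sum.reindex_bij_witness[of _ "\<lambda>C. C + D" "\<lambda>C. C - D"])
         (use D' in \<open>auto simp: polys_below_add polys_below_diff\<close>)
    moreover have "lam ((C + D)\<^sup>2) = lam (C\<^sup>2) + lam (smult 2 C * D)" for C
    proof -
      have "(C + D)\<^sup>2 = C\<^sup>2 + smult 2 C * D + D\<^sup>2"
        by (simp add: power2_sum numeral_poly algebra_simps)
      then show ?thesis
        using D2[OF D] by (simp add: lam_add)
    qed
    ultimately show "tau h = (\<Sum>C\<in>polys_below n. h (lam (C\<^sup>2) + lam (smult 2 C * D)))"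
      by simp
  qed simp
  also have "\<dots> = (\<Sum>C\<in>polys_below n. \<Sum>D\<in>polys_below s. h (lam (C\<^sup>2) + lam (smult 2 C * D)))"
    by (rule sum.swap)
  also have "\<dots> = (\<Sum>C\<in>polys_below (n - s). \<Sum>D\<in>polys_below s. h (lam (C\<^sup>2) + lam (smult 2 C * D)))"
  proof (rule sum.mono_neutral_right)
    show "\<forall>C\<in>polys_below n - polys_below (n - s).
        (\<Sum>D\<in>polys_below s. h (lam (C\<^sup>2) + lam (smult 2 C * D))) = 0"
    proof
      fix C :: "'a poly" assume C: "C \<in> polys_below n - polys_below (n - s)"
      then have "smult 2 C \<in> polys_below n" "smult 2 C \<notin> polys_below (n - s)"
        using two_neq_zero[OF odd_card] by (auto simp: polys_below_iff)
      then show "(\<Sum>D\<in>polys_below s. h (lam (C\<^sup>2) + lam (smult 2 C * D))) = 0"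
        using h s by (intro sum_h_lam_mult_eq_0[of _ "n - s"]) auto
    qed
  qed (use polys_below_mono[of "n - s" n] in auto)
  also have "\<dots> = (\<Sum>C\<in>polys_below (n - s). \<Sum>D\<in>(polys_below s :: 'a poly set). h (lam (C\<^sup>2)))"
  proof (intro sum.cong refl)
    fix C D :: "'a poly" assume "C \<in> polys_below (n - s)" "D \<in> polys_below s"
    then have "smult 2 C * D \<in> polys_below (n - 1)"
      using s by (intro polys_below_mult[of _ "n - s" _ s] polys_below_smult) auto
    then show "h (lam (C\<^sup>2) + lam (smult 2 C * D)) = h (lam (C\<^sup>2))"
      by (simp add: lam_eq_0)
  qed
  also have "\<dots> = int (CARD('a) ^ s) * (\<Sum>C\<in>polys_below (n - s). h (lam (C\<^sup>2)))"
    by (simp add: card_polys_below sum_distrib_left)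
  finally show ?thesis
    by simp
qed

text \<open>The coefficient of u ^ k in the L-function of the character modulo P.\<close>

definition chi_sum :: "nat \<Rightarrow> int" where
  "chi_sum k = (\<Sum>B\<in>monic_polys k. chi B)"

text \<open>Expand \<open>chi B\<close> by \<open>sum_chi_h_lam_mult\<close> and sum over B first.
  As B runs over a coset of \<open>polys_below m\<close>, only A in the dual space
  \<open>polys_below (Suc k)\<close> survive, and for these \<open>lam (A * B)\<close> is the
  coefficient of A at k.\<close>

lemma tau_mult_chi_sum:
  assumes h: "(\<Sum>a\<in>UNIV. h a) = 0" and km: "k + m + 1 = n"
  shows "chi_sum m * tau h = CARD('a) ^ m * (\<Sum>A\<in>polys_below (Suc k). chi A * h (coeff A k))"
proof -
  have "chi_sum m * tau h = (\<Sum>B\<in>monic_polys m. \<Sum>A\<in>polys_below n. chi A * h (lam (A * B)))"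
    unfolding chi_sum_def sum_distrib_right
  proof (rule sum.cong)
    fix B :: "'a poly" assume B: "B \<in> monic_polys m"
    then have "B \<in> polys_below n" "B \<noteq> 0"
      using km by (auto simp: monic_polys_def intro!: polys_belowI)
    then have "\<not> P dvd B"
      by (simp add: P_dvd_below_iff)
    then show "chi B * tau h = (\<Sum>A\<in>polys_below n. chi A * h (lam (A * B)))"
      by (simp add: sum_chi_h_lam_mult)
  qed simp
  also have "\<dots> = (\<Sum>A\<in>polys_below n. \<Sum>B\<in>monic_polys m. chi A * h (lam (A * B)))"
    by (rule sum.swap)
  also have "\<dots> = (\<Sum>A\<in>polys_below n. chi A * (\<Sum>B\<in>polys_below m. h (lam (A * monom 1 m) + lam (A * B))))"
    by (simp add: sum_monic_polys sum_distrib_left distrib_left lam_add)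
  also have "\<dots> = (\<Sum>A\<in>polys_below (Suc k). chi A *
      (\<Sum>B\<in>polys_below m. h (lam (A * monom 1 m) + lam (A * B))))"
  proof (rule sum.mono_neutral_right)
    show "\<forall>A\<in>polys_below n - polys_below (Suc k). chi A *
      (\<Sum>B\<in>polys_below m. h (lam (A * monom 1 m) + lam (A * B))) = 0"
    proof
      fix A :: "'a poly" assume "A \<in> polys_below n - polys_below (Suc k)"
      then have "(\<Sum>B\<in>polys_below m. h (lam (A * monom 1 m) + lam (A * B))) = 0"
        using h km by (intro sum_h_lam_mult_eq_0[of A "Suc k"]) auto
      then show "chi A * (\<Sum>B\<in>polys_below m. h (lam (A * monom 1 m) + lam (A * B))) = 0"
        by simp
    qed
  qed (use km polys_below_mono[of "Suc k" n] in auto)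
  also have "\<dots> = (\<Sum>A\<in>polys_below (Suc k). chi A * (CARD('a) ^ m * h (coeff A k)))"
  proof (intro sum.cong refl arg_cong2[where f = "(*)"])
    fix A :: "'a poly" assume A: "A \<in> polys_below (Suc k)"
    have "A * monom 1 m \<in> polys_below n"
      using A km by (intro polys_below_mult[of _ "Suc k" _ "Suc m"]) (auto intro!: polys_belowI simp: degree_monom_eq)
    then have "lam (A * monom 1 m) = coeff (A * monom 1 m) (n - 1)"
      by (rule lam_below)
    also have "\<dots> = coeff (A * monom 1 m) (k + m)"
      using km by (intro arg_cong[where f = "coeff _"]) simp
    also have "\<dots> = coeff A k"
      by (simp add: mult.commute[of A] coeff_monom_mult)
    finally have 1: "lam (A * monom 1 m) = coeff A k" .
    have "lam (A * B) = 0" if "B \<in> polys_below m" for B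
      using A that km by (intro lam_eq_0 polys_below_mult[of _ "Suc k" _ m]) auto
    then show "(\<Sum>B\<in>polys_below m. h (lam (A * monom 1 m) + lam (A * B))) = CARD('a) ^ m * h (coeff A k)"
      by (simp add: 1 card_polys_below)
  qed
  finally show ?thesis
    by (simp add: sum_distrib_left mult_ac)
qed

lemma chi_smult: "chi (smult c A) = chi [:c:] * chi A"
  using chi_mult[of "[:c:]" A] by simp

text \<open>Take for h the symbol on constants. The scalars c in c * B then cancel on the dual side,
  so that both sides carry a factor q - 1, which is removed.\<close>

lemma chi_sum_duality_odd:
  assumes "odd n" and km: "k + m + 1 = n"
  shows "CARD('a) ^ (n div 2) * chi_sum m = CARD('a) ^ m * chi_sum k"
proof -
  let ?h = "\<lambda>a. chi [:a:]"
  define s where "s = n div 2"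
  have n: "n = 2 * s + 1"
    using assms(1) by (simp add: s_def)
  have sq: "?h c * ?h c = 1" if "c \<noteq> 0" for c
    using that chi_cases[of "[:c:]"] by (auto simp: chi_eq_0_iff P_dvd_const_iff)
  have coeff: "coeff B l = 1" if "B \<in> monic_polys l" for B :: "'a poly" and l
    using that by (auto simp: monic_polys_def)
  have "tau ?h = (\<Sum>C\<in>polys_below (Suc s). ?h (lam (C\<^sup>2)))"
    using tau_eq[OF sum_chi_const_odd[OF assms(1)] s_def] by (simp add: n Suc_diff_le)
  \<comment> \<open>C has degree at most s and n - 1 = 2 * s, so \<open>lam\<close> sees only the
    square of the coefficient at s, whose symbol is 1 unless it is 0.\<close>
  also have "\<dots> = (\<Sum>C\<in>polys_below (Suc s). ?h ((coeff C s)\<^sup>2))"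
  proof (rule sum.cong)
    fix C :: "'a poly" assume C: "C \<in> polys_below (Suc s)"
    then have C0: "coeff C i = 0" if "i > s" for i
      using that by (simp add: polys_below_def)
    have "coeff (C * C) (s + s) = (\<Sum>i\<in>{s}. coeff C i * coeff C (s + s - i))"
      unfolding coeff_mult
    proof (rule sum.mono_neutral_right)
      show "\<forall>i\<in>{..s + s} - {s}. coeff C i * coeff C (s + s - i) = 0"
      proof
        fix i assume "i \<in> {..s + s} - {s}"
        then have "i > s \<or> s + s - i > s"
          by auto
        then show "coeff C i * coeff C (s + s - i) = 0"
          using C0 by auto
      qed
    qed auto
    then have "coeff (C * C) (s + s) = coeff C s * coeff C s"
      by simp
    moreover have "C * C \<in> polys_below n"
      using C n by (intro polys_below_mult[of _ "Suc s" _ "Suc s"]) auto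
    moreover have "n - 1 = s + s"
      using n by simp
    ultimately show "?h (lam (C\<^sup>2)) = ?h ((coeff C s)\<^sup>2)"
      by (simp only: lam_below power2_eq_square)
  qed simp
  also have "\<dots> = (\<Sum>C\<in>(polys_below s :: 'a poly set). 0) + (\<Sum>c\<in>UNIV-{0::'a}. \<Sum>B\<in>(monic_polys s :: 'a poly set). 1)"
    unfolding sum_polys_below_Suc
  proof (intro arg_cong2[where f = "(+)"] sum.cong refl)
    fix C :: "'a poly" assume "C \<in> polys_below s"
    then show "?h ((coeff C s)\<^sup>2) = 0"
      by (simp add: polys_below_def)
  next
    fix c :: 'a and B :: "'a poly" assume "c \<in> UNIV - {0}" "B \<in> monic_polys s"
    then show "?h ((coeff (smult c B) s)\<^sup>2) = 1"
      using sq[of c] chi_mult[of "[:c:]" "[:c:]"] by (simp add: coeff power2_eq_square)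
  qed
  also have "\<dots> = (CARD('a) - 1) * CARD('a) ^ s"
    by (simp add: card_monic_polys card_Diff_singleton)
  finally have tau: "tau ?h = (CARD('a) - 1) * CARD('a) ^ s" .
  have "(\<Sum>A\<in>polys_below (Suc k). chi A * ?h (coeff A k))
      = (\<Sum>C\<in>(polys_below k :: 'a poly set). 0) + (\<Sum>c\<in>UNIV-{0::'a}. \<Sum>B\<in>monic_polys k. chi B)"
    unfolding sum_polys_below_Suc
  proof (intro arg_cong2[where f = "(+)"] sum.cong refl)
    fix C :: "'a poly" assume "C \<in> polys_below k"
    then show "chi C * ?h (coeff C k) = 0"
      by (simp add: polys_below_def)
  next
    fix c :: 'a and B :: "'a poly" assume "c \<in> UNIV - {0}" "B \<in> monic_polys k"
    then show "chi (smult c B) * ?h (coeff (smult c B) k) = chi B"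
      using sq[of c] by (simp add: coeff chi_smult)
  qed
  also have "\<dots> = int (CARD('a) - 1) * chi_sum k"
    by (simp add: chi_sum_def card_Diff_singleton)
  finally have "int (CARD('a) - 1) * (CARD('a) ^ s * chi_sum m)
      = int (CARD('a) - 1) * (CARD('a) ^ m * chi_sum k)"
    using tau_mult_chi_sum[OF sum_chi_const_odd[OF assms(1)] km] tau by (simp add: mult_ac)
  moreover have "int (CARD('a) - 1) \<noteq> 0"
    using card_field_ge_2[where 'a = 'a] by simp
  ultimately show ?thesis
    unfolding s_def using mult_left_cancel by blast
qed

text \<open>For even n nonzero constants have symbol 1, so the kernel is q - 1 at 0 and -1
  elsewhere. It gives A the weight q - 1 if its degree is below k and -1 if it is k. In
  \<open>tau\<close> every surviving C has \<open>lam (C\<^sup>2)\<close> equal to 0.\<close>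

lemma chi_sum_duality_even:
  assumes "even n" and km: "k + m + 1 = n"
  shows "CARD('a) ^ (n div 2) * chi_sum m
    = CARD('a) ^ m * ((int CARD('a) - 1) * (\<Sum>j<k. chi_sum j) - chi_sum k)"
proof -
  let ?q = "int CARD('a)"
  define h where "h = (\<lambda>a::'a. if a = 0 then ?q - 1 else -1)"
  define s where "s = n div 2"
  have n: "n = 2 * s"
    using assms(1) by (simp add: s_def)
  have "(\<Sum>a\<in>UNIV. h a) = h 0 + (\<Sum>a\<in>UNIV-{0}. h a)"
    by (rule sum.remove) auto
  also have "(\<Sum>a\<in>UNIV-{0}. h a) = (\<Sum>a\<in>UNIV-{0::'a}. -1)"
    by (rule sum.cong) (auto simp: h_def)
  finally have h: "(\<Sum>a\<in>UNIV. h a) = 0"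
    using card_field_ge_2[where 'a = 'a] by (simp add: h_def card_Diff_singleton of_nat_diff)
  have card: "int (card (UNIV - {0::'a})) = ?q - 1"
    using card_field_ge_2[where 'a = 'a] by (simp add: card_Diff_singleton of_nat_diff)
  have coeff: "coeff B l = 1" if "B \<in> monic_polys l" for B :: "'a poly" and l
    using that by (auto simp: monic_polys_def)
  have chi1: "chi (smult c B) = chi B" if "c \<noteq> 0" for c B
    using that by (simp add: chi_smult chi_const_even[OF assms(1)])
  have "tau h = (\<Sum>C\<in>polys_below s. h (lam (C\<^sup>2)))"
    using tau_eq[OF h s_def] by (simp add: n)
  also have "\<dots> = (\<Sum>C\<in>(polys_below s :: 'a poly set). ?q - 1)"
  proof (rule sum.cong)
    fix C :: "'a poly" assume C: "C \<in> polys_below s"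
    then have "C * C \<in> polys_below (n - 1)"
      using n by (intro polys_below_mult[of _ s _ s]) auto
    then show "h (lam (C\<^sup>2)) = ?q - 1"
      by (simp add: lam_eq_0 power2_eq_square h_def)
  qed simp
  finally have tau: "tau h = (?q - 1) * ?q ^ s"
    by (simp add: card_polys_below)
  have below: "(\<Sum>A\<in>polys_below l. chi A) = (?q - 1) * (\<Sum>j<l. chi_sum j)" for l
  proof (induction l)
    case (Suc l)
    have "(\<Sum>c\<in>UNIV-{0}. \<Sum>B\<in>monic_polys l. chi (smult c B))
        = (\<Sum>c\<in>UNIV-{0::'a}. \<Sum>B\<in>monic_polys l. chi B)"
      by (intro sum.cong refl) (simp add: chi1)
    then show ?case
      by (simp add: sum_polys_below_Suc Suc card chi_sum_def distrib_left)
  qed simp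
  have "(\<Sum>A\<in>polys_below (Suc k). chi A * h (coeff A k))
      = (\<Sum>A\<in>polys_below k. chi A * (?q - 1)) + (\<Sum>c\<in>UNIV-{0::'a}. \<Sum>B\<in>monic_polys k. - chi B)"
    unfolding sum_polys_below_Suc
  proof (intro arg_cong2[where f = "(+)"] sum.cong refl)
    fix C :: "'a poly" assume "C \<in> polys_below k"
    then show "chi C * h (coeff C k) = chi C * (?q - 1)"
      by (simp add: polys_below_def h_def)
  next
    fix c :: 'a and B :: "'a poly" assume "c \<in> UNIV - {0}" "B \<in> monic_polys k"
    then show "chi (smult c B) * h (coeff (smult c B) k) = - chi B"
      by (simp add: coeff chi1 h_def)
  qed
  also have "\<dots> = (?q - 1) * ((?q - 1) * (\<Sum>j<k. chi_sum j) - chi_sum k)"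
  proof -
    have "(\<Sum>A\<in>polys_below k. chi A * (?q - 1)) = (?q - 1) * (\<Sum>j<k. chi_sum j) * (?q - 1)"
      by (simp only: below flip: sum_distrib_right)
    moreover have "(\<Sum>c\<in>UNIV-{0::'a}. \<Sum>B\<in>monic_polys k. - chi B) = (?q - 1) * - chi_sum k"
      by (simp add: card sum_negf chi_sum_def)
    ultimately have "(\<Sum>A\<in>polys_below k. chi A * (?q - 1)) + (\<Sum>c\<in>UNIV-{0::'a}. \<Sum>B\<in>monic_polys k. - chi B)
        = (?q - 1) * (\<Sum>j<k. chi_sum j) * (?q - 1) + (?q - 1) * - chi_sum k"
      by (rule arg_cong2[where f = "(+)"])
    also have "\<dots> = (?q - 1) * ((?q - 1) * (\<Sum>j<k. chi_sum j) - chi_sum k)"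
      by (simp add: algebra_simps)
    finally show ?thesis .
  qed
  finally have "(?q - 1) * (?q ^ s * chi_sum m)
      = (?q - 1) * (?q ^ m * ((?q - 1) * (\<Sum>j<k. chi_sum j) - chi_sum k))"
    using tau_mult_chi_sum[OF h km] tau by (simp add: mult_ac)
  moreover have "?q - 1 \<noteq> 0"
    using card_field_ge_2[where 'a = 'a] by simp
  ultimately show ?thesis
    unfolding s_def using mult_left_cancel by (metis of_nat_power)
qed

end

section \<open>The asymptotic formula\<close>

lemma S_duality_odd:
  assumes odd: "odd CARD('a::{field,finite})" and n: "odd n" "k + m + 1 = n"
  shows "CARD('a) ^ (n div 2) * S TYPE('a) m n = CARD('a) ^ m * S TYPE('a) k n"
  unfolding S_def sum_distrib_left[of _ _ "monic_irreducibles n"]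
proof (rule sum.cong)
  fix P :: "'a poly" assume "P \<in> monic_irreducibles n"
  then interpret odd_irreducible_modulus P n
    by unfold_locales (auto simp: odd)
  show "CARD('a) ^ (n div 2) * (\<Sum>B\<in>monic_polys m. chi B) = CARD('a) ^ m * (\<Sum>B\<in>monic_polys k. chi B)"
    using chi_sum_duality_odd[OF n] by (simp add: chi_sum_def)
qed simp

lemma S_duality_even:
  assumes odd: "odd CARD('a::{field,finite})" and n: "even n" "k + m + 1 = n"
  shows "CARD('a) ^ (n div 2) * S TYPE('a) m n
    = CARD('a) ^ m * ((int CARD('a) - 1) * (\<Sum>j<k. S TYPE('a) j n) - S TYPE('a) k n)"
proof -
  have "(\<Sum>j<k. S TYPE('a) j n)
      = (\<Sum>P\<in>monic_irreducibles n. \<Sum>j<k. \<Sum>B\<in>monic_polys j. quad_symbol B (P :: 'a poly))"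
    unfolding S_def by (rule sum.swap)
  then have "CARD('a) ^ m * ((int CARD('a) - 1) * (\<Sum>j<k. S TYPE('a) j n) - S TYPE('a) k n)
      = (\<Sum>P\<in>monic_irreducibles n. CARD('a) ^ m * ((int CARD('a) - 1) *
        (\<Sum>j<k. \<Sum>B\<in>monic_polys j. quad_symbol B (P :: 'a poly)) - (\<Sum>B\<in>monic_polys k. quad_symbol B P)))"
    by (simp only: S_def[of _ k] sum_distrib_left[of _ _ "monic_irreducibles n"] flip: sum_subtractf)
  also have "\<dots> = (\<Sum>P\<in>monic_irreducibles n. CARD('a) ^ (n div 2) * (\<Sum>B\<in>monic_polys m. quad_symbol B (P :: 'a poly)))"
  proof (rule sum.cong)
    fix P :: "'a poly" assume "P \<in> monic_irreducibles n"
    then interpret odd_irreducible_modulus P n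
      by unfold_locales (auto simp: odd)
    show "CARD('a) ^ m * ((int CARD('a) - 1) * (\<Sum>j<k. \<Sum>B\<in>monic_polys j. chi B) - (\<Sum>B\<in>monic_polys k. chi B))
        = CARD('a) ^ (n div 2) * (\<Sum>B\<in>monic_polys m. chi B)"
      using chi_sum_duality_even[OF n] by (simp add: chi_sum_def)
  qed simp
  also have "\<dots> = CARD('a) ^ (n div 2) * S TYPE('a) m n"
    by (simp only: S_def sum_distrib_left[of _ _ "monic_irreducibles n"])
  finally show ?thesis ..
qed

text \<open>This secures the size condition of \<open>stepanov_sum\<close>, where the degree of B is
  at most 2 * s. At s = 3 the inequality fails, as 28 > 27.\<close>

lemma linear_le_power_3: "s \<ge> 4 \<Longrightarrow> 8 * s + 4 \<le> (3::nat) ^ s"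
  by (induction s rule: nat_induct_at_least) auto

text \<open>Stepanov's bound applies when \<open>n div 2\<close> is at least 4, and rounding
  \<open>n - n div 2\<close> costs one factor q. Otherwise n <= 7, and the trivial bound by the
  number of irreducibles gives q ^ 7.\<close>

lemma character_sum_bound:
  fixes B :: "'a::{field,finite} poly"
  assumes odd: "odd CARD('a)" and B: "lead_coeff B = 1" "\<nexists>C. B = C\<^sup>2" and deg: "degree B < n"
  shows "\<bar>\<Sum>P\<in>monic_irreducibles n. quad_symbol B P\<bar>
    \<le> int ((13 * CARD('a) + CARD('a) ^ 7) * CARD('a) ^ (n div 2))"
proof -
  let ?q = "CARD('a)" and ?s = "n div 2"
  have q: "?q \<ge> 3"
    using odd card_field_ge_2[where 'a = 'a] by (cases "?q = 2") auto
  show ?thesis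
  proof (cases "?s \<ge> 4")
    case True
    have "4 * degree B + 4 \<le> 8 * ?s + 4"
      using deg by simp
    also have "\<dots> \<le> 3 ^ ?s"
      using True by (rule linear_le_power_3)
    also have "\<dots> \<le> ?q ^ ?s"
      using q by (rule power_mono) simp
    finally have "\<bar>\<Sum>P\<in>monic_irreducibles n. quad_symbol B P\<bar> \<le> int (13 * ?q ^ (n - ?s))"
      using stepanov_sum[OF odd B deg] by simp
    also have "13 * ?q ^ (n - ?s) \<le> 13 * ?q ^ Suc ?s"
      using q by (intro mult_le_mono2 power_increasing) auto
    also have "\<dots> \<le> (13 * ?q + ?q ^ 7) * ?q ^ ?s"
      by (simp add: algebra_simps)
    finally show ?thesis
      by simp
  next
    case False
    have "\<bar>\<Sum>P\<in>monic_irreducibles n. quad_symbol B P\<bar> \<le> (\<Sum>P\<in>(monic_irreducibles n :: 'a poly set). 1)"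
      by (rule order_trans[OF sum_abs], rule sum_mono) (simp add: quad_symbol_def)
    also have "\<dots> = int (prime_count TYPE('a) n)"
      by (simp add: prime_count_def)
    also have "prime_count TYPE('a) n \<le> n * prime_count TYPE('a) n"
      using deg by simp
    also have "\<dots> \<le> ?q ^ n"
      by (rule prime_count_le)
    also have "\<dots> \<le> ?q ^ 7"
      using False q by (intro power_increasing) auto
    also have "\<dots> \<le> (13 * ?q + ?q ^ 7) * 1"
      by simp
    also have "\<dots> \<le> (13 * ?q + ?q ^ 7) * ?q ^ ?s"
      using q by (intro mult_le_mono2) simp
    finally show ?thesis
      by simp
  qed
qed

text \<open>A root of a monic square is monic up to sign, and exactly one of C and -C is monic since
  2 is not 0.\<close>

lemma card_monic_squares:
  assumes odd: "odd CARD('a::{field,finite})"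
  shows "card {B \<in> monic_polys k. \<exists>C :: 'a poly. B = C\<^sup>2} = (if even k then CARD('a) ^ (k div 2) else 0)"
proof (cases "even k")
  case True
  then obtain j where k: "k = 2 * j" by blast
  have "{B \<in> monic_polys k. \<exists>C :: 'a poly. B = C\<^sup>2} = (\<lambda>C. C\<^sup>2) ` monic_polys j"
  proof (intro equalityI subsetI)
    fix B :: "'a poly" assume "B \<in> {B \<in> monic_polys k. \<exists>C :: 'a poly. B = C\<^sup>2}"
    then obtain C where C: "B = C\<^sup>2" "B \<in> monic_polys k"
      by blast
    then have "C \<noteq> 0"
      by (auto simp: monic_polys_def)
    then have "(lead_coeff C)\<^sup>2 = 1" "2 * degree C = k"
      using C(2) by (auto simp: C(1) monic_polys_def degree_power_eq simp flip: lead_coeff_power)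
    then have "degree C = j" "lead_coeff C = 1 \<or> lead_coeff C = -1"
      by (auto simp: k power2_eq_1_iff)
    then have "C \<in> monic_polys j \<or> - C \<in> monic_polys j"
      by (auto simp: monic_polys_def)
    then show "B \<in> (\<lambda>C. C\<^sup>2) ` monic_polys j"
      using C(1) by (auto intro: image_eqI[of _ _ C] image_eqI[of _ _ "- C"])
  next
    fix B :: "'a poly" assume "B \<in> (\<lambda>C. C\<^sup>2) ` monic_polys j"
    then obtain C where "B = C\<^sup>2" "C \<in> monic_polys j"
      by blast
    moreover from this have "C \<noteq> 0"
      by (auto simp: monic_polys_def)
    ultimately show "B \<in> {B \<in> monic_polys k. \<exists>C :: 'a poly. B = C\<^sup>2}"
      using lead_coeff_power[of C 2] by (auto simp: monic_polys_def k degree_power_eq)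
  qed
  moreover have "inj_on (\<lambda>C. C\<^sup>2) (monic_polys j :: 'a poly set)"
  proof (rule inj_onI)
    fix C D :: "'a poly" assume CD: "C \<in> monic_polys j" "D \<in> monic_polys j" "C\<^sup>2 = D\<^sup>2"
    have "C \<noteq> - D"
    proof
      assume "C = - D"
      then have "(1 :: 'a) = - 1"
        using CD by (auto simp: monic_polys_def)
      then have "(2 :: 'a) = 0"
        by (metis add.right_inverse one_add_one)
      then show False
        using two_neq_zero[OF odd] by simp
    qed
    then show "C = D"
      using CD(3) by (simp add: power2_eq_iff)
  qed
  ultimately show ?thesis
    using True by (simp add: card_image card_monic_polys k)
next
  case False
  have "{B \<in> monic_polys k. \<exists>C :: 'a poly. B = C\<^sup>2} = {}"
  proof safe
    fix C :: "'a poly" assume "C\<^sup>2 \<in> monic_polys k"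
    then have "C \<noteq> 0" "degree (C\<^sup>2) = k"
      by (auto simp: monic_polys_def)
    then show "C\<^sup>2 \<in> {}"
      using False by (auto simp: degree_power_eq)
  qed
  then show ?thesis
    using False by (simp only: if_False card.empty)
qed

text \<open>Exchange the summations. A square of degree below n has symbol 1 at every P, which gives
  the main term; each of the at most q ^ k other B falls under
  \<open>character_sum_bound\<close>.\<close>

lemma S_estimate:
  assumes odd: "odd CARD('a::{field,finite})" and "k < n"
  shows "\<bar>S TYPE('a) k n - (if even k then int (prime_count TYPE('a) n * CARD('a) ^ (k div 2)) else 0)\<bar>
    \<le> int ((13 * CARD('a) + CARD('a) ^ 7) * CARD('a) ^ (n div 2) * CARD('a) ^ k)"
proof -
  let ?K = "int ((13 * CARD('a) + CARD('a) ^ 7) * CARD('a) ^ (n div 2))"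
  let ?T = "\<lambda>B :: 'a poly. \<Sum>P\<in>monic_irreducibles n. quad_symbol B P"
  let ?Q = "{B \<in> monic_polys k. \<exists>C :: 'a poly. B = C\<^sup>2}"
  have T: "?T B = int (prime_count TYPE('a) n)" if "B \<in> ?Q" for B
  proof -
    obtain C where C: "B = C\<^sup>2" and B: "B \<in> monic_polys k"
      using \<open>B \<in> ?Q\<close> by blast
    have "quad_symbol B P = 1" if "P \<in> monic_irreducibles n" for P
    proof -
      interpret irreducible_modulus P n
        by unfold_locales (rule that)
      have "B \<in> polys_below n" "B \<noteq> 0"
        using B \<open>k < n\<close> by (auto simp: monic_polys_def intro: polys_belowI)
      then have "\<not> P dvd C\<^sup>2"
        unfolding C[symmetric] by (simp add: P_dvd_below_iff)
      then show ?thesis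
        unfolding C by (intro chi_power2) (simp add: P_dvd_power_iff)
    qed
    then show ?thesis
      by (simp add: prime_count_def)
  qed
  have "S TYPE('a) k n = (\<Sum>B\<in>monic_polys k. ?T B)"
    unfolding S_def by (rule sum.swap)
  also have "\<dots> = (\<Sum>B\<in>?Q. ?T B) + (\<Sum>B\<in>monic_polys k - ?Q. ?T B)"
    by (subst sum.subset_diff[of ?Q]) (auto simp: finite_monic_polys)
  also have "(\<Sum>B\<in>?Q. ?T B) = int (card ?Q) * int (prime_count TYPE('a) n)"
    using T by simp
  also have "\<dots> = (if even k then int (prime_count TYPE('a) n * CARD('a) ^ (k div 2)) else 0)"
    unfolding card_monic_squares[OF odd] by simp
  finally have "\<bar>S TYPE('a) k n - (if even k then int (prime_count TYPE('a) n * CARD('a) ^ (k div 2)) else 0)\<bar>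
      = \<bar>\<Sum>B\<in>monic_polys k - ?Q. ?T B\<bar>"
    by simp
  also have "\<dots> \<le> (\<Sum>B\<in>monic_polys k - ?Q. \<bar>?T B\<bar>)"
    by (rule sum_abs)
  also have "\<dots> \<le> (\<Sum>B\<in>monic_polys k - ?Q. ?K)"
  proof (rule sum_mono)
    fix B :: "'a poly" assume "B \<in> monic_polys k - ?Q"
    then show "\<bar>?T B\<bar> \<le> ?K"
      using \<open>k < n\<close> by (intro character_sum_bound[OF odd]) (auto simp: monic_polys_def)
  qed
  also have "\<dots> \<le> (\<Sum>B\<in>(monic_polys k :: 'a poly set). ?K)"
    by (rule sum_mono2) (auto simp: finite_monic_polys)
  also have "\<dots> = int ((13 * CARD('a) + CARD('a) ^ 7) * CARD('a) ^ (n div 2) * CARD('a) ^ k)"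
    by (simp add: card_monic_polys)
  finally show ?thesis .
qed

theorem theorem3p1:
  fixes q :: nat
  assumes "q = CARD('a::{field,finite})" and "odd q"
  shows "\<exists>C::real. \<forall>n \<beta> :: nat. n \<ge> 1 \<and> even \<beta> \<and> \<beta> \<noteq> 0 \<and> \<beta> < n \<longrightarrow>
    \<bar>real_of_int (S TYPE('a) \<beta> n)
       - real (prime_count TYPE('a) n)
         * (real q powr (real \<beta> / 2) - eta n * real q powr (real \<beta> - real n / 2))\<bar>
    \<le> C * real q ^ n"
proof -
  \<comment> \<open>The constant of \<open>character_sum_bound\<close>, depending only on q; the
    final constant is 2 * K.\<close>
  define K where "K = real (13 * q + q ^ 7)"
  have odd: "odd CARD('a)" and q: "real q \<ge> 1"
    using assms card_field_ge_2[where 'a = 'a] by auto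
  have "K \<ge> 0"
    by (simp add: K_def)
  \<comment> \<open>The functional equations have a power of q on either side; this passes from them
    to absolute values.\<close>
  have mult_abs_eq: "c * \<bar>x\<bar> = d * \<bar>y\<bar>" if "c * x = d * y" "0 \<le> c" "0 \<le> d" for c d x y :: real
    using that by (metis abs_mult abs_of_nonneg)
  have "\<bar>real_of_int (S TYPE('a) \<beta> n) - real (prime_count TYPE('a) n)
       * (real q powr (real \<beta> / 2) - eta n * real q powr (real \<beta> - real n / 2))\<bar> \<le> 2 * K * real q ^ n"
    if "even \<beta>" "\<beta> < n" for n \<beta>
  proof -
    \<comment> \<open>k is the degree dual to \<beta> under the functional equation.\<close>
    define s k where "s = n div 2" and "k = n - 1 - \<beta>"
    have k: "k + \<beta> + 1 = n" "k < n"
      using that by (simp_all add: k_def)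
    define \<pi> where "\<pi> = real (prime_count TYPE('a) n)"
    define T where "T j = real_of_int (S TYPE('a) j n)" for j
    define M where "M j = (if even j then \<pi> * real q ^ (j div 2) else 0)" for j
    have estimate: "\<bar>T j - M j\<bar> \<le> K * real q ^ s * real q ^ j" if "j < n" for j
    proof -
      have "real_of_int \<bar>S TYPE('a) j n - (if even j then int (prime_count TYPE('a) n * CARD('a) ^ (j div 2)) else 0)\<bar>
        \<le> real_of_int (int ((13 * CARD('a) + CARD('a) ^ 7) * CARD('a) ^ (n div 2) * CARD('a) ^ j))"
        using S_estimate[OF odd that] by (rule of_int_le_iff[THEN iffD2])
      then show ?thesis
        by (cases "even j") (simp_all add: T_def M_def \<pi>_def K_def s_def assms(1))
    qed
    obtain b where b: "\<beta> = 2 * b"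
      using \<open>even \<beta>\<close> by blast
    have powr1: "real q powr (real \<beta> / 2) = real q ^ b"
      using q by (simp add: b powr_realpow)
    have "real q ^ (\<beta> + k) \<le> real q ^ n"
      using q k by (intro power_increasing) auto
    then have pow_le: "K * real q ^ (\<beta> + k) \<le> K * real q ^ n"
      using \<open>K \<ge> 0\<close> by (rule mult_left_mono)
    show ?thesis
    proof (cases "even n")
      case False
      then have n: "n = 2 * s + 1"
        by (simp add: s_def)
      then obtain j where j: "k = 2 * j" "s = b + j"
        using k b by (intro that[of "s - b"]) auto
      have "real_of_int (int (q ^ s) * S TYPE('a) \<beta> n) = real_of_int (int (q ^ \<beta>) * S TYPE('a) k n)"
        using S_duality_odd[OF odd False k(1)] by (simp only: assms(1) s_def)
      \<comment> \<open>Here \<beta> + j = s + b, so \<open>M k\<close> on the dual side corresponds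
        exactly to the main term for \<beta>.\<close>
      then have "real q ^ s * (T \<beta> - \<pi> * real q ^ b) = real q ^ \<beta> * (T k - M k)"
        by (simp add: T_def M_def j b algebra_simps power_add power_mult power2_eq_square)
      then have "real q ^ s * \<bar>T \<beta> - \<pi> * real q ^ b\<bar> = real q ^ \<beta> * \<bar>T k - M k\<bar>"
        by (rule mult_abs_eq) auto
      also have "\<dots> \<le> real q ^ \<beta> * (K * real q ^ s * real q ^ k)"
        by (intro mult_left_mono estimate k) auto
      \<comment> \<open>The q ^ s of the estimate cancels the q ^ s on the left, and the error is K
        * q ^ (\<beta> + k) = K * q ^ (n - 1).\<close>
      also have "\<dots> = real q ^ s * (K * real q ^ (\<beta> + k))"
        by (simp add: power_add)
      finally have "\<bar>T \<beta> - \<pi> * real q ^ b\<bar> \<le> K * real q ^ (\<beta> + k)"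
        using q by simp
      also have "\<dots> \<le> 2 * K * real q ^ n"
      proof -
        have "0 \<le> K * real q ^ n"
          using \<open>K \<ge> 0\<close> by simp
        then show ?thesis
          using pow_le by linarith
      qed
      finally show ?thesis
        using False by (simp add: powr1 eta_def T_def \<pi>_def)
    next
      case True
      then have n: "n = 2 * s"
        by (simp add: s_def)
      then obtain j where j: "k = 2 * j + 1" "s = b + j + 1"
        using k b by (intro that[of "s - b - 1"]) auto
      have powr2: "real q powr (real \<beta> - real n / 2) = real q ^ \<beta> / real q ^ s"
        using q by (simp add: n powr_diff powr_realpow)
      have "real_of_int (int (q ^ s) * S TYPE('a) \<beta> n)
          = real_of_int (int (q ^ \<beta>) * ((int q - 1) * (\<Sum>i<k. S TYPE('a) i n) - S TYPE('a) k n))"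
        using S_duality_even[OF odd True k(1)] by (simp only: assms(1) s_def)
      then have dual: "real q ^ s * T \<beta> = real q ^ \<beta> * ((real q - 1) * (\<Sum>i<k. T i) - T k)"
        by (simp add: T_def)
      \<comment> \<open>Only even i contribute, which gives a geometric sum in q. As k is odd,
        \<open>M k\<close> is 0. The -1 on the right becomes the secondary term with
        \<open>eta\<close>.\<close>
      have "(real q - 1) * (\<Sum>i<2 * l + 1. M i) = \<pi> * (real q ^ (l + 1) - 1)" for l
        by (induction l) (simp_all add: M_def algebra_simps)
      then have main: "(real q - 1) * (\<Sum>i<k. M i) - M k = \<pi> * (real q ^ (j + 1) - 1)"
        by (simp add: j M_def)
      have "(real q - 1) * (\<Sum>i<k. real q ^ i) = real q ^ k - 1"
        by (rule power_diff_1_eq[symmetric])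
      then have geometric: "(real q - 1) * (\<Sum>i<k. real q ^ i) \<le> real q ^ k"
        by simp
      have "real q ^ s * (T \<beta> - \<pi> * (real q ^ b - real q ^ \<beta> / real q ^ s))
          = real q ^ s * T \<beta> - \<pi> * (real q ^ (s + b) - real q ^ \<beta>)"
        using q by (simp add: algebra_simps power_add)
      also have "real q ^ (s + b) = real q ^ \<beta> * real q ^ (j + 1)"
      proof -
        have "s + b = \<beta> + (j + 1)"
          by (simp add: b j(2))
        then show ?thesis
          by (simp only: power_add)
      qed
      finally have "real q ^ s * (T \<beta> - \<pi> * (real q ^ b - real q ^ \<beta> / real q ^ s))
          = real q ^ \<beta> * (((real q - 1) * (\<Sum>i<k. T i) - T k) - ((real q - 1) * (\<Sum>i<k. M i) - M k))"
        unfolding dual main by (simp only: right_diff_distrib mult_ac mult_1_right)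
      also have "\<dots> = real q ^ \<beta> * ((real q - 1) * (\<Sum>i<k. T i - M i) - (T k - M k))"
        by (simp add: sum_subtractf algebra_simps)
      finally have "real q ^ s * \<bar>T \<beta> - \<pi> * (real q ^ b - real q ^ \<beta> / real q ^ s)\<bar>
          = real q ^ \<beta> * \<bar>(real q - 1) * (\<Sum>i<k. T i - M i) - (T k - M k)\<bar>"
        by (rule mult_abs_eq) auto
      also have "\<bar>(real q - 1) * (\<Sum>i<k. T i - M i) - (T k - M k)\<bar>
          \<le> \<bar>(real q - 1) * (\<Sum>i<k. T i - M i)\<bar> + \<bar>T k - M k\<bar>"
        by (rule abs_triangle_ineq4)
      also have "\<bar>(real q - 1) * (\<Sum>i<k. T i - M i)\<bar> = (real q - 1) * \<bar>\<Sum>i<k. T i - M i\<bar>"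
        using q by (simp add: abs_mult)
      also have "\<bar>\<Sum>i<k. T i - M i\<bar> \<le> (\<Sum>i<k. K * real q ^ s * real q ^ i)"
        using k by (intro order_trans[OF sum_abs] sum_mono estimate) auto
      also have "\<bar>T k - M k\<bar> \<le> K * real q ^ s * real q ^ k"
        by (intro estimate k)
      also have "(real q - 1) * (\<Sum>i<k. K * real q ^ s * real q ^ i)
          = K * real q ^ s * ((real q - 1) * (\<Sum>i<k. real q ^ i))"
        by (simp add: sum_distrib_left mult_ac)
      \<comment> \<open>The weight q - 1 compensates the geometric sum, so all degrees below k
        together cost no more than degree k; hence the factor 2.\<close>
      also have "\<dots> \<le> K * real q ^ s * real q ^ k"
        using geometric \<open>K \<ge> 0\<close> by (intro mult_left_mono) auto
      finally have "real q ^ s * \<bar>T \<beta> - \<pi> * (real q ^ b - real q ^ \<beta> / real q ^ s)\<bar>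
          \<le> real q ^ \<beta> * (K * real q ^ s * real q ^ k + K * real q ^ s * real q ^ k)"
        using q by (simp add: mult_left_mono)
      also have "\<dots> = real q ^ s * (2 * (K * real q ^ (\<beta> + k)))"
        by (simp add: power_add)
      finally have "\<bar>T \<beta> - \<pi> * (real q ^ b - real q ^ \<beta> / real q ^ s)\<bar> \<le> 2 * (K * real q ^ (\<beta> + k))"
        using q by simp
      also have "\<dots> \<le> 2 * K * real q ^ n"
        using pow_le by simp
      finally show ?thesis
        using True by (simp add: powr1 powr2 eta_def T_def \<pi>_def)
    qed
  qed
  then show ?thesis
    by blast
qed

end
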